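(* Let $\mathcal{Z}$ be an arc diagram. The creation operator $A^*_{\mathcal{C}}$ of a creation choice function $\mathcal{C}$ for $\mathcal{Z}$ preserves H-grading, has Maslov degree $1$, and satisfies $$A^*_{\mathcal{C}}\,\partial+\partial\,A^*_{\mathcal{C}}=1$$ on $\bigoplus_{(h,s,t)\in\mathbf{w}}\mathcal{A}(h,s,t)$. Moreover, for any cycle $x\in\bigoplus_{(h,s,t)\in\mathbf{w}}\mathcal{A}(h,s,t)$, we have $x=\partial A^*_{\mathcal{C}}x$.
   Context: All algebra is over $\mathbb{Z}_2$. An arc diagram $\mathcal{Z}=(\mathbf{Z},\mathbf{a},r)$ consists of oriented intervals $\mathbf{Z}=\{Z_1,\dots,Z_l\}$, distinct points $\mathbf{a}=(a_1,\dots,a_{2k})$ (places) in the interiors of the intervals, ordered along them, and a 2-to-1 map $r:\mathbf{a}\to\{1,\dots,k\}$ such that oriented surgery on $\mathbf{Z}$ at all $0$-spheres $r^{-1}(i)$ yields a 1-manifold with no circle components. The fibres $P=\{p,q\}$ of $r$ are the matched pairs, identified with $1,\dots,k$. Let $-\infty_i,+\infty_i$ be the start and end of $Z_i$ and $\mathbf{a}_{\pm\infty}=\mathbf{a}\cup\{\pm\infty_i\}$, partially ordered along the intervals; the places cut the intervals into steps. A strand diagram is a triple $(S,T,\phi)$ with $S,T\subseteq\mathbf{a}_{\pm\infty}$ and $\phi:S\to T$ a bijection with $\phi(x)\ge x$; it is drawn as strands in $[0,1]\times\mathbf{Z}$ from $\{0\}\times S$ to $\{1\}\times T$, meeting efficiently;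 crossings are inversions ($x<y$ with $\phi(x)>\phi(y)$), counted by $\mathrm{inv}$. The product of $(S,T,\phi)$ and $(U,V,\psi)$ is $(S,V,\psi\phi)$ if $T=U$ and $\mathrm{inv}(\psi\phi)=\mathrm{inv}(\phi)+\mathrm{inv}(\psi)$, and $0$ otherwise; $\partial$ is the sum of all resolutions of one crossing which lower the number of crossings by exactly $1$. $I(S)$ is the identity diagram on $S$. For a set $s$ of matched pairs let $I(s)=\sum_S I(S)$, over all $S\subseteq \mathbf{a}_{\pm\infty}$ consisting of exactly one place of each pair in $s$, no other places, and any subset of $\{\pm\infty_i\}$. For $\mu=(S,T,\phi)$ without horizontal strands (fixed points) let $a(\mu)=\sum_U(S\cup U,T\cup U,\phi_U)$ over $U\subseteq\mathbf{a}_{\pm\infty}\setminus(S\cup T)$, $\phi_U$ extending $\phi$ by the identity. A diagram from $s$ to $t$ is a nonzero element $I(s)a(\mu)I(t)$; it is drawn as one picture with dotted horizontal strands at both places $p,q$ of every matched pair carrying a horizontal strand. The (augmented) strand algebra $\mathcal{A}=\mathcal{A}(\mathcal{Z})$ is the DGA with basis the diagrams. H-data is a triple $(h,s,t)$ with $h\in H_1(\mathbf{Z},\mathbf{a}_{\pm\infty})$ and $s,t$ sets of matched pairs. A diagram from $s$ to $t$ has H-grading $h=\sum_x[x,\phi(x)]$ and H-data $(h,s,t)$; $\mathcal{A}(h,s,t)$ is the span of diagrams with this H-data (a subcomplex). The Maslov grading is $\iota(D)=\mathrm{inv}(\mu)-m(h,S)$ for any term $\mu=(S,T,\phi)$ of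 $D$, where $m(h,S)$ is the sum over places $a\in S\cap\mathbf{a}$ of the average multiplicity of $h$ on the two steps at $a$. $h$ (and any H-data or diagram with H-grading $h$) is viable if $h$ has multiplicity $0$ or $1$ on every step. In a viable diagram every crossing involves a horizontal strand, hence lies at a matched pair. A viable diagram is twisted if it has no crossings and is zero in the homology of $\mathcal{A}$. Viable H-data is twisted if some twisted diagram has that H-data; $\mathbf{w}$ is the set of twisted H-data. A matched pair $P=\{p,q\}$ is 11 (all-on) once occupied at $p$ by $(h,s,t)$ if $P\in s$, $P\in t$, and $h$ covers both steps adjacent to $p$ and neither step adjacent to $q$; every twisted $(h,s,t)$ has such a pair. A creation choice function $\mathcal{C}$ assigns to each $(h,s,t)\in\mathbf{w}$ one of its 11 once occupied pairs $\mathcal{C}(h,s,t)$. The creation operator $A^*_{\mathcal{C}}:\bigoplus_{\mathbf{w}}\mathcal{A}(h,s,t)\to\bigoplus_{\mathbf{w}}\mathcal{A}(h,s,t)$ is the linear map given on a diagram $D\in\mathcal{A}(h,s,t)$ as follows, with $P=\{p,q\}=\mathcal{C}(h,s,t)$ once occupied at $p$: if $D$ has a crossing at $P$, $A^*_{\mathcal{C}}D=0$; otherwise one strand of $D$ ends at $p$ and another begins at $p$, and $A^*_{\mathcal{C}}D$ is obtained by joining these into a single strand running past $p$ and adding dotted horizontal strands at $p$ and $q$. *)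

theory Defs
  imports Complex_Main "HOL-Library.Poly_Mapping" "HOL-Library.Z2"
begin

section \<open>Vector spaces over the field with two elements\<close>

definition scale2 :: "bit \<Rightarrow> ('a \<Rightarrow>\<^sub>0 bit) \<Rightarrow> ('a \<Rightarrow>\<^sub>0 bit)" where
  "scale2 c = Poly_Mapping.map ((*) c)"

lemma lookup_scale2: "Poly_Mapping.lookup (scale2 c x) k = c * Poly_Mapping.lookup x k"
  by (simp add: scale2_def Poly_Mapping.map.rep_eq when_def)

global_interpretation F2: vector_space "scale2 :: bit \<Rightarrow> ('a \<Rightarrow>\<^sub>0 bit) \<Rightarrow> ('a \<Rightarrow>\<^sub>0 bit)"
  by unfold_locales
    (rule poly_mapping_eqI; simp only: lookup_scale2 lookup_add algebra_simps mult_1_left)+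

global_interpretation F2_pair: vector_space_pair
    "scale2 :: bit \<Rightarrow> ('a \<Rightarrow>\<^sub>0 bit) \<Rightarrow> ('a \<Rightarrow>\<^sub>0 bit)"
    "scale2 :: bit \<Rightarrow> ('b \<Rightarrow>\<^sub>0 bit) \<Rightarrow> ('b \<Rightarrow>\<^sub>0 bit)"
  by unfold_locales


section \<open>Arc diagrams\<close>

text \<open>
  The interval number \<open>i\<close> carries \<open>n = num_places Z ! i\<close> places.  Its marked points, in order, are
  \<open>(i, 0)\<close> (its start), the places \<open>(i, 1), \<dots>, (i, n)\<close>, and \<open>(i, n + 1)\<close> (its end).  The step
  \<open>(i, j)\<close> runs from the point \<open>(i, j)\<close> to the point \<open>(i, j + 1)\<close>.
\<close>

type_synonym point = "nat \<times> nat"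
type_synonym step = "nat \<times> nat"

record arc_diagram =
  num_places :: "nat list"
  num_pairs :: nat
  matching :: "point \<Rightarrow> nat"

definition points :: "arc_diagram \<Rightarrow> point set" where
  "points Z = {(i, j). i < length (num_places Z) \<and> j \<le> num_places Z ! i + 1}"

definition places :: "arc_diagram \<Rightarrow> point set" where
  "places Z = {(i, j). i < length (num_places Z) \<and> 1 \<le> j \<and> j \<le> num_places Z ! i}"

definition steps :: "arc_diagram \<Rightarrow> step set" where
  "steps Z = {(i, j). i < length (num_places Z) \<and> j \<le> num_places Z ! i}"

definition pairs :: "arc_diagram \<Rightarrow> nat set" where
  "pairs Z = {1..num_pairs Z}"

definition point_le :: "point \<Rightarrow> point \<Rightarrow> bool" where
  "point_le x y \<longleftrightarrow> fst x = fst y \<and> snd x \<le> snd y"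

definition point_less :: "point \<Rightarrow> point \<Rightarrow> bool" where
  "point_less x y \<longleftrightarrow> fst x = fst y \<and> snd x < snd y"

text \<open>
  Oriented surgery at all the matched pairs glues the end of the step ending at a place \<open>p\<close> to the
  beginning of the step starting at the place matched with \<open>p\<close>.  This relation on steps is a
  partial injection, so the resulting 1-manifold has a circle component if and only if the
  relation has a cycle.
\<close>

definition surgery :: "arc_diagram \<Rightarrow> (step \<times> step) set" where
  "surgery Z = {((i, j), q) | i j q. (i, j + 1) \<in> places Z \<and> q \<in> places Z \<and>
     q \<noteq> (i, j + 1) \<and> matching Z q = matching Z (i, j + 1)}"

definition is_arc_diagram :: "arc_diagram \<Rightarrow> bool" where
  "is_arc_diagram Z \<longleftrightarrow>
     matching Z ` places Z \<subseteq> pairs Z \<and>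
     (\<forall>P\<in>pairs Z. card {a \<in> places Z. matching Z a = P} = 2) \<and>
     acyclic (surgery Z)"


section \<open>Strand diagrams\<close>

text \<open>A strand diagram \<open>(S, T, \<phi>)\<close> is the partial map \<open>\<phi>\<close> with domain \<open>S\<close> and range \<open>T\<close>.\<close>

type_synonym strands = "point \<rightharpoonup> point"
type_synonym alg = "strands \<Rightarrow>\<^sub>0 bit"

definition strand_diagram :: "arc_diagram \<Rightarrow> strands \<Rightarrow> bool" where
  "strand_diagram Z \<mu> \<longleftrightarrow> dom \<mu> \<subseteq> points Z \<and> ran \<mu> \<subseteq> points Z \<and> inj_on \<mu> (dom \<mu>) \<and>
     (\<forall>x y. \<mu> x = Some y \<longrightarrow> point_le x y)"

definition crossings :: "strands \<Rightarrow> (point \<times> point) set" where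
  "crossings \<mu> = {(x, y). x \<in> dom \<mu> \<and> y \<in> dom \<mu> \<and> point_less x y \<and>
     point_less (the (\<mu> y)) (the (\<mu> x))}"

definition inversions :: "strands \<Rightarrow> nat" where
  "inversions \<mu> = card (crossings \<mu>)"

definition basis :: "strands \<Rightarrow> alg" where
  "basis \<mu> = Poly_Mapping.single \<mu> 1"

definition strand_mult :: "strands \<Rightarrow> strands \<Rightarrow> alg" where
  "strand_mult \<phi> \<psi> =
     (if ran \<phi> = dom \<psi> \<and> inversions (\<psi> \<circ>\<^sub>m \<phi>) = inversions \<phi> + inversions \<psi>
      then basis (\<psi> \<circ>\<^sub>m \<phi>) else 0)"

definition alg_mult :: "alg \<Rightarrow> alg \<Rightarrow> alg"  (infixl "\<odot>" 70) where
  "x \<odot> y = (\<Sum>\<phi>\<in>Poly_Mapping.keys x. \<Sum>\<psi>\<in>Poly_Mapping.keys y. strand_mult \<phi> \<psi>)"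

definition resolve :: "strands \<Rightarrow> point \<times> point \<Rightarrow> strands" where
  "resolve \<mu> c = \<mu>(fst c := \<mu> (snd c), snd c := \<mu> (fst c))"

definition strand_diff :: "strands \<Rightarrow> alg" where
  "strand_diff \<mu> =
     (\<Sum>c\<in>{c \<in> crossings \<mu>. inversions (resolve \<mu> c) + 1 = inversions \<mu>}. basis (resolve \<mu> c))"

definition diff :: "alg \<Rightarrow> alg" where
  "diff x = (\<Sum>\<mu>\<in>Poly_Mapping.keys x. strand_diff \<mu>)"

definition identity_on :: "point set \<Rightarrow> strands" where
  "identity_on S = (\<lambda>x. if x \<in> S then Some x else None)"

definition sections :: "arc_diagram \<Rightarrow> nat set \<Rightarrow> point set set" where
  "sections Z s = {S. S \<subseteq> points Z \<and> matching Z ` (S \<inter> places Z) \<subseteq> s \<and>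
     (\<forall>P\<in>s. \<exists>!a. a \<in> S \<inter> places Z \<and> matching Z a = P)}"

definition idem :: "arc_diagram \<Rightarrow> nat set \<Rightarrow> alg" where
  "idem Z s = (\<Sum>S\<in>sections Z s. basis (identity_on S))"

definition no_horizontal :: "strands \<Rightarrow> bool" where
  "no_horizontal \<mu> \<longleftrightarrow> (\<forall>x. \<mu> x \<noteq> Some x)"

definition fill :: "arc_diagram \<Rightarrow> strands \<Rightarrow> alg" where
  "fill Z \<mu> = (\<Sum>U\<in>Pow (points Z - (dom \<mu> \<union> ran \<mu>)). basis (\<mu> ++ identity_on U))"


section \<open>Diagrams, gradings and the strand algebra\<close>

text \<open>
  The group \<open>H\<^sub>1(\<^bold>Z, \<^bold>a\<^sub>\<plusminus>\<^sub>\<infinity>)\<close> is free abelian on the steps; a class is given by its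
  multiplicities on the steps.
\<close>

type_synonym homology_class = "step \<Rightarrow>\<^sub>0 int"
type_synonym hdata = "homology_class \<times> nat set \<times> nat set"

definition segment :: "point \<Rightarrow> point \<Rightarrow> homology_class" where
  "segment x y = (\<Sum>j\<in>{snd x..<snd y}. Poly_Mapping.single (fst x, j) 1)"

definition hclass :: "strands \<Rightarrow> homology_class" where
  "hclass \<mu> = (\<Sum>x\<in>dom \<mu>. segment x (the (\<mu> x)))"

definition hdata :: "arc_diagram \<Rightarrow> hdata set" where
  "hdata Z = {(h, s, t). Poly_Mapping.keys h \<subseteq> steps Z \<and> s \<subseteq> pairs Z \<and> t \<subseteq> pairs Z}"

definition mk_diagram :: "arc_diagram \<Rightarrow> nat set \<Rightarrow> strands \<Rightarrow> nat set \<Rightarrow> alg" where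
  "mk_diagram Z s \<mu> t = idem Z s \<odot> fill Z \<mu> \<odot> idem Z t"

definition presents :: "arc_diagram \<Rightarrow> nat set \<times> strands \<times> nat set \<Rightarrow> alg \<Rightarrow> bool" where
  "presents Z = (\<lambda>(s, \<mu>, t) D. s \<subseteq> pairs Z \<and> t \<subseteq> pairs Z \<and> strand_diagram Z \<mu> \<and>
     no_horizontal \<mu> \<and> D = mk_diagram Z s \<mu> t \<and> D \<noteq> 0)"

definition diagrams :: "arc_diagram \<Rightarrow> alg set" where
  "diagrams Z = {D. \<exists>d. presents Z d D}"

definition diagrams_of :: "arc_diagram \<Rightarrow> hdata \<Rightarrow> alg set" where
  "diagrams_of Z = (\<lambda>(h, s, t). {D. \<exists>\<mu>. presents Z (s, \<mu>, t) D \<and> hclass \<mu> = h})"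

definition strand_algebra :: "arc_diagram \<Rightarrow> alg set" where
  "strand_algebra Z = F2.span (diagrams Z)"

definition h_part :: "arc_diagram \<Rightarrow> homology_class \<Rightarrow> alg set" where
  "h_part Z h = F2.span (\<Union>s\<in>Pow (pairs Z). \<Union>t\<in>Pow (pairs Z). diagrams_of Z (h, s, t))"

definition strand_maslov :: "arc_diagram \<Rightarrow> strands \<Rightarrow> rat" where
  "strand_maslov Z \<mu> = of_nat (inversions \<mu>) -
     (\<Sum>(i, j)\<in>dom \<mu> \<inter> places Z.
        of_int (Poly_Mapping.lookup (hclass \<mu>) (i, j - 1) + Poly_Mapping.lookup (hclass \<mu>) (i, j)) / 2)"

text \<open>All terms of a diagram have the same value of \<^const>\<open>strand_maslov\<close>.\<close>

definition maslov :: "arc_diagram \<Rightarrow> alg \<Rightarrow> rat" where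
  "maslov Z D = strand_maslov Z (SOME \<mu>. \<mu> \<in> Poly_Mapping.keys D)"

definition maslov_part :: "arc_diagram \<Rightarrow> rat \<Rightarrow> alg set" where
  "maslov_part Z g = F2.span {D \<in> diagrams Z. maslov Z D = g}"


section \<open>Twisted H-data and creation operators\<close>

definition viable :: "arc_diagram \<Rightarrow> homology_class \<Rightarrow> bool" where
  "viable Z h \<longleftrightarrow> (\<forall>e\<in>steps Z. Poly_Mapping.lookup h e \<in> {0, 1})"

definition zero_in_homology :: "arc_diagram \<Rightarrow> alg \<Rightarrow> bool" where
  "zero_in_homology Z x \<longleftrightarrow> x \<in> strand_algebra Z \<and> diff x = 0 \<and> x \<in> diff ` strand_algebra Z"

text \<open>
  The picture of a diagram has a dotted horizontal strand at both places of a matched pair, whereas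
  each of its terms uses one of the two.  So a crossing of the picture appears in some, but not
  necessarily all, of the terms.
\<close>

definition crossingless :: "alg \<Rightarrow> bool" where
  "crossingless D \<longleftrightarrow> (\<forall>\<nu>\<in>Poly_Mapping.keys D. crossings \<nu> = {})"

definition crossing_at :: "arc_diagram \<Rightarrow> nat \<Rightarrow> alg \<Rightarrow> bool" where
  "crossing_at Z P D \<longleftrightarrow> (\<exists>\<nu>\<in>Poly_Mapping.keys D. \<exists>(x, y)\<in>crossings \<nu>. \<exists>a\<in>{x, y}.
     \<nu> a = Some a \<and> a \<in> places Z \<and> matching Z a = P)"

definition twisted_hdata :: "arc_diagram \<Rightarrow> hdata set" where
  "twisted_hdata Z = {(h, s, t) \<in> hdata Z. viable Z h \<and>
     (\<exists>D\<in>diagrams_of Z (h, s, t). crossingless D \<and> zero_in_homology Z D)}"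

definition twisted_sum :: "arc_diagram \<Rightarrow> alg set" where
  "twisted_sum Z = F2.span (\<Union>d\<in>twisted_hdata Z. diagrams_of Z d)"

definition all_on_once_occupied :: "arc_diagram \<Rightarrow> hdata \<Rightarrow> nat \<Rightarrow> point \<Rightarrow> bool" where
  "all_on_once_occupied Z = (\<lambda>(h, s, t) P p. P \<in> s \<and> P \<in> t \<and> p \<in> places Z \<and> matching Z p = P \<and>
     Poly_Mapping.lookup h (fst p, snd p - 1) = 1 \<and> Poly_Mapping.lookup h p = 1 \<and>
     (\<forall>q\<in>places Z. matching Z q = P \<and> q \<noteq> p \<longrightarrow>
        Poly_Mapping.lookup h (fst q, snd q - 1) = 0 \<and> Poly_Mapping.lookup h q = 0))"

definition creation_choice :: "arc_diagram \<Rightarrow> (hdata \<Rightarrow> nat) \<Rightarrow> bool" where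
  "creation_choice Z C \<longleftrightarrow> (\<forall>d\<in>twisted_hdata Z. \<exists>p. all_on_once_occupied Z d (C d) p)"

definition join_at :: "point \<Rightarrow> strands \<Rightarrow> strands" where
  "join_at p \<mu> = (\<lambda>x. if x = p then None else if \<mu> x = Some p then \<mu> p else \<mu> x)"

text \<open>
  A diagram determines the triple \<open>(s, \<mu>, t)\<close> presenting it, and an all-on once occupied pair
  determines the place at which it is occupied.  After joining, the matched pair \<open>P\<close> still lies in
  \<open>s\<close> and \<open>t\<close> but no end of a moving strand lies on it, so that \<^const>\<open>mk_diagram\<close> puts the dotted
  horizontal strands at both of its places.
\<close>

definition create_diagram :: "arc_diagram \<Rightarrow> (hdata \<Rightarrow> nat) \<Rightarrow> alg \<Rightarrow> alg" where
  "create_diagram Z C D =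
     (let (s, \<mu>, t) = (THE d. presents Z d D);
          P = C (hclass \<mu>, s, t);
          p = (THE p. all_on_once_occupied Z (hclass \<mu>, s, t) P p)
      in if crossing_at Z P D then 0 else mk_diagram Z s (join_at p \<mu>) t)"

text \<open>
  The linear map given by \<^const>\<open>create_diagram\<close> on the diagrams with twisted H-data, which are
  linearly independent.
\<close>

definition creation_operator :: "arc_diagram \<Rightarrow> (hdata \<Rightarrow> nat) \<Rightarrow> alg \<Rightarrow> alg" where
  "creation_operator Z C =
     F2_pair.construct (\<Union>d\<in>twisted_hdata Z. diagrams_of Z d) (create_diagram Z C)"

end

theory Submission
  imports Defs
begin

text \<open>
  A viable diagram with H-data \<open>(h, s, t)\<close> is determined by the set \<open>B\<close> of places covered on both
  sides by \<open>h\<close> at which a strand ends and another begins, since \<open>h\<close> and \<open>B\<close> determine where strands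
  start.  In these terms the differential sums over the ways of adding to \<open>B\<close> a place with a
  crossing, and the creation operator removes from \<open>B\<close> the place \<open>p\<close> at which the chosen pair is
  occupied (giving \<open>0\<close> if \<open>p \<notin> B\<close>).  As the other place of the pair is not covered at all, \<open>p\<close> is
  either in \<open>B\<close> or has a crossing, and the presence of \<open>p\<close> in \<open>B\<close> does not affect the other
  crossings.  So in the sum of the two composites everything cancels except the term that adds and
  removes \<open>p\<close>.
\<close>

section \<open>Viable strand diagrams without horizontal strands\<close>

text \<open>Moving strands are compared through \<open>hclass\<close> and \<open>dom\<close> alone
  (\<open>viable_moving_eqI\<close>), so that identities between cut and joined strands reduce to
  identities between sets of places. The obstacle is that an element of the algebra is a sum of
  terms, and each term keeps only one of the two places of a pair carrying a horizontal strand; a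
  crossing of the picture may therefore be absent from a given term. At a once occupied pair this
  can be repaired: a horizontal strand at the uncovered place crosses nothing, so exchanging it for
  one at \<open>p\<close> keeps all other crossings of the term (\<open>occupied_swap\<close>). The
  statements on gradings concern elements lying in two spans at once. They reduce to single diagrams
  because any one term of a diagram determines the triple presenting it, so that distinct diagrams
  share no terms and are linearly independent.\<close>

declare split_paired_All [simp del] split_paired_Ex [simp del]

lemma finite_points: "finite (points Z)"
proof -
  have "points Z = (SIGMA i:{..<length (num_places Z)}. {..num_places Z ! i + 1})"
    by (auto simp: points_def)
  then show ?thesis by simp
qed

lemma places_subset_points: "places Z \<subseteq> points Z"
  by (auto simp: places_def points_def)

lemma finite_dom_strand_diagram: "strand_diagram Z \<mu> \<Longrightarrow> finite (dom \<mu>)"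
  by (meson finite_points finite_subset strand_diagram_def)

lemma strand_diagram_points:
  assumes "strand_diagram Z \<mu>" "\<mu> x = Some y"
  shows "x \<in> points Z" "y \<in> points Z" "fst x = fst y" "snd x \<le> snd y"
  using assms unfolding strand_diagram_def point_le_def by (auto intro: ranI)

lemma strand_diagram_inj:
  assumes "strand_diagram Z \<mu>" "\<mu> x = Some y" "\<mu> x' = Some y"
  shows "x = x'"
  using assms unfolding strand_diagram_def by (metis domI inj_onD)

section \<open>Multiplicities of the homology class and its boundary\<close>

lemma lookup_segment:
  "Poly_Mapping.lookup (segment x y) (i, j) = of_bool (fst x = i \<and> snd x \<le> j \<and> j < snd y)"
proof -
  have "Poly_Mapping.lookup (segment x y) (i, j)
      = (\<Sum>k\<in>{snd x..<snd y}. if k = j then of_bool (fst x = i) else 0)"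
    unfolding segment_def lookup_sum
    by (intro sum.cong) (auto simp: lookup_single when_def)
  then show ?thesis by (auto simp: sum.delta)
qed

definition covering :: "strands \<Rightarrow> step \<Rightarrow> point set" where
  "covering \<mu> e = {x \<in> dom \<mu>. fst x = fst e \<and> snd x \<le> snd e \<and> snd e < snd (the (\<mu> x))}"

lemma lookup_hclass:
  assumes "finite (dom \<mu>)"
  shows "Poly_Mapping.lookup (hclass \<mu>) e = int (card (covering \<mu> e))"
proof -
  have "Poly_Mapping.lookup (hclass \<mu>) e
      = (\<Sum>x\<in>dom \<mu>. of_bool (fst x = fst e \<and> snd x \<le> snd e \<and> snd e < snd (the (\<mu> x))))"
    unfolding hclass_def lookup_sum
    by (cases e) (simp add: lookup_segment)
  also have "\<dots> = int (card (covering \<mu> e))"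
    unfolding covering_def using assms
    by (simp add: of_bool_def sum.If_cases Int_def)
  finally show ?thesis .
qed

lemma lookup_hclass_neq_0_iff:
  assumes "finite (dom \<mu>)"
  shows "Poly_Mapping.lookup (hclass \<mu>) e \<noteq> 0 \<longleftrightarrow>
    (\<exists>x y. \<mu> x = Some y \<and> fst x = fst e \<and> snd x \<le> snd e \<and> snd e < snd y)"
proof -
  have "finite (covering \<mu> e)" using assms by (simp add: covering_def)
  then have "Poly_Mapping.lookup (hclass \<mu>) e \<noteq> 0 \<longleftrightarrow> covering \<mu> e \<noteq> {}"
    using assms by (simp add: lookup_hclass)
  also have "\<dots> \<longleftrightarrow> (\<exists>x\<in>dom \<mu>. fst x = fst e \<and> snd x \<le> snd e \<and> snd e < snd (the (\<mu> x)))"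
    by (auto simp: covering_def)
  finally show ?thesis by (metis domD domI option.sel)
qed

lemma keys_hclass_subset_steps:
  assumes "strand_diagram Z \<mu>"
  shows "Poly_Mapping.keys (hclass \<mu>) \<subseteq> steps Z"
proof
  fix e assume "e \<in> Poly_Mapping.keys (hclass \<mu>)"
  then obtain x y where "\<mu> x = Some y" "fst x = fst e" "snd e < snd y"
    using lookup_hclass_neq_0_iff[OF finite_dom_strand_diagram[OF assms]]
    by (metis in_keys_iff)
  with strand_diagram_points[OF assms, of x y] show "e \<in> steps Z"
    by (cases e; cases x; cases y) (auto simp: points_def steps_def)
qed

text \<open>The boundary of a segment is its end minus its start, and injectivity lets at most one
  strand end at a point. This is the source of all later arguments that trade "a strand ends here"
  for "a strand starts here". The form \<open>Suc j\<close> ensures that there is a step before the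
  point.\<close>

lemma hclass_boundary:
  assumes "strand_diagram Z \<mu>"
  shows "Poly_Mapping.lookup (hclass \<mu>) (i, Suc j) - Poly_Mapping.lookup (hclass \<mu>) (i, j)
    = of_bool ((i, Suc j) \<in> dom \<mu>) - of_bool ((i, Suc j) \<in> ran \<mu>)"
proof -
  let ?z = "(i, Suc j)"
  have fin: "finite (dom \<mu>)" by (rule finite_dom_strand_diagram[OF assms])
  have "Poly_Mapping.lookup (hclass \<mu>) (i, Suc j) - Poly_Mapping.lookup (hclass \<mu>) (i, j)
      = (\<Sum>x\<in>dom \<mu>. Poly_Mapping.lookup (segment x (the (\<mu> x))) (i, Suc j)
          - Poly_Mapping.lookup (segment x (the (\<mu> x))) (i, j))"
    unfolding hclass_def lookup_sum by (simp add: sum_subtractf)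
  also have "\<dots> = (\<Sum>x\<in>dom \<mu>. of_bool (x = ?z) - of_bool (the (\<mu> x) = ?z))"
  proof (rule sum.cong[OF refl])
    fix x assume "x \<in> dom \<mu>"
    then obtain y where "\<mu> x = Some y" by auto
    with strand_diagram_points[OF assms this]
    show "Poly_Mapping.lookup (segment x (the (\<mu> x))) (i, Suc j)
        - Poly_Mapping.lookup (segment x (the (\<mu> x))) (i, j)
        = of_bool (x = ?z) - of_bool (the (\<mu> x) = ?z)"
      by (cases x; cases y) (auto simp: lookup_segment)
  qed
  also have "\<dots> = (\<Sum>x\<in>dom \<mu>. of_bool (x = ?z)) - (\<Sum>x\<in>dom \<mu>. of_bool (the (\<mu> x) = ?z))"
    by (rule sum_subtractf)
  also have "(\<Sum>x\<in>dom \<mu>. of_bool (x = ?z)) = (of_bool (?z \<in> dom \<mu>) :: int)"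
    using fin by (simp add: of_bool_def)
  also have "(\<Sum>x\<in>dom \<mu>. of_bool (the (\<mu> x) = ?z)) = (of_bool (?z \<in> ran \<mu>) :: int)"
  proof (cases "?z \<in> ran \<mu>")
    case True
    then obtain w where w: "\<mu> w = Some ?z" by (auto simp: ran_def)
    have "(\<Sum>x\<in>dom \<mu>. of_bool (the (\<mu> x) = ?z)) = (\<Sum>x\<in>dom \<mu>. if x = w then 1 else (0::int))"
    proof (rule sum.cong[OF refl])
      fix x assume "x \<in> dom \<mu>"
      then obtain y where y: "\<mu> x = Some y" by auto
      have "y = ?z \<longleftrightarrow> x = w" using strand_diagram_inj[OF assms] y w by (metis option.inject)
      with y show "of_bool (the (\<mu> x) = ?z) = (if x = w then 1 else (0::int))" by simp
    qed
    also have "\<dots> = 1" using fin w by auto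
    finally show ?thesis using True by simp
  next
    case False
    then have "(\<Sum>x\<in>dom \<mu>. of_bool (the (\<mu> x) = ?z)) = (0::int)"
      by (intro sum.neutral) (auto simp: ran_def)
    with False show ?thesis by simp
  qed
  finally show ?thesis .
qed

section \<open>Viable systems of moving strands\<close>

definition viable_moving :: "arc_diagram \<Rightarrow> strands \<Rightarrow> bool" where
  "viable_moving Z \<mu> \<longleftrightarrow> strand_diagram Z \<mu> \<and> no_horizontal \<mu> \<and> viable Z (hclass \<mu>)"

lemma viable_moving_finite: "viable_moving Z \<mu> \<Longrightarrow> finite (dom \<mu>)"
  using finite_dom_strand_diagram viable_moving_def by blast

text \<open>Viability speaks only of the steps of the arc diagram; on all other indices the
  multiplicity vanishes because strands stay inside the intervals.\<close>

lemma viable_moving_lookup: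
  assumes "viable_moving Z \<mu>"
  shows "Poly_Mapping.lookup (hclass \<mu>) e \<in> {0, 1}"
  using assms keys_hclass_subset_steps[of Z \<mu>]
  by (cases "e \<in> steps Z") (auto simp: viable_moving_def viable_def in_keys_iff)

lemma viable_moving_less:
  assumes "viable_moving Z \<mu>" "\<mu> x = Some y"
  shows "fst x = fst y" "snd x < snd y"
proof -
  have "strand_diagram Z \<mu>" using assms by (simp add: viable_moving_def)
  note * = strand_diagram_points[OF this assms(2)]
  show "fst x = fst y" by (fact *(3))
  have "x \<noteq> y" using assms unfolding viable_moving_def no_horizontal_def by metis
  with * show "snd x < snd y" by (metis le_neq_implies_less prod_eqI)
qed

text \<open>Multiplicity at most 1 leaves no room for a second strand over the same step. This is
  the standard way below to identify two strands.\<close>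

lemma viable_moving_covering_unique:
  assumes "viable_moving Z \<mu>"
    and "\<mu> x = Some y" "fst x = i" "snd x \<le> j" "j < snd y"
    and "\<mu> x' = Some y'" "fst x' = i" "snd x' \<le> j" "j < snd y'"
  shows "x = x'"
proof -
  have fin: "finite (covering \<mu> (i, j))"
    using viable_moving_finite[OF assms(1)] by (simp add: covering_def)
  have "card (covering \<mu> (i, j)) \<le> 1"
    using viable_moving_lookup[OF assms(1), of "(i, j)"]
    by (auto simp: lookup_hclass viable_moving_finite[OF assms(1)])
  moreover have "x \<in> covering \<mu> (i, j)" "x' \<in> covering \<mu> (i, j)"
    using assms by (auto simp: covering_def)
  ultimately show ?thesis using fin by (metis One_nat_def card_le_Suc0_iff_eq)
qed

lemma viable_moving_start:
  assumes "viable_moving Z \<mu>" "x \<in> dom \<mu>"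
  shows "Poly_Mapping.lookup (hclass \<mu>) x = 1"
proof -
  obtain y where "\<mu> x = Some y" using assms(2) by auto
  then have "Poly_Mapping.lookup (hclass \<mu>) x \<noteq> 0"
    using viable_moving_less[OF assms(1)] viable_moving_finite[OF assms(1)]
    by (metis lookup_hclass_neq_0_iff order_refl)
  with viable_moving_lookup[OF assms(1), of x] show ?thesis by auto
qed

text \<open>If a strand starting at \<open>x\<close> could end at \<open>y\<close> or, farther on, at \<open>y'\<close>, then another strand
  would have to start at \<open>y\<close> in the first case, hence in both, and overlap in the second.\<close>

lemma viable_moving_eqI:
  assumes v: "viable_moving Z \<mu>" "viable_moving Z \<mu>'"
    and h: "hclass \<mu> = hclass \<mu>'" and d: "dom \<mu> = dom \<mu>'"
  shows "\<mu> = \<mu>'"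
proof -
  have not_less: "\<not> snd y < snd y'"
    if v: "viable_moving Z \<mu>" "viable_moving Z \<mu>'"
      and h: "hclass \<mu> = hclass \<mu>'" and d: "dom \<mu> = dom \<mu>'"
      and x: "\<mu> x = Some y" "\<mu>' x = Some y'" for \<mu> \<mu>' x y y'
  proof
    assume less: "snd y < snd y'"
    note xy = viable_moving_less[OF v(1) x(1)] viable_moving_less[OF v(2) x(2)]
    obtain j where sj: "snd y = Suc j" using xy by (cases "snd y") auto
    then have j: "y = (fst x, Suc j)" using xy(1) by (simp add: prod_eq_iff)
    have "Poly_Mapping.lookup (hclass \<mu>) (fst x, Suc j) \<noteq> 0"
      unfolding h lookup_hclass_neq_0_iff[OF viable_moving_finite[OF v(2)]]
      using x(2) xy less sj by (intro exI[of _ x] exI[of _ y']) auto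
    moreover have "Poly_Mapping.lookup (hclass \<mu>) (fst x, j) \<noteq> 0"
      unfolding lookup_hclass_neq_0_iff[OF viable_moving_finite[OF v(1)]]
      using x(1) xy less sj by (intro exI[of _ x] exI[of _ y]) auto
    moreover have "y \<in> ran \<mu>" using x(1) by (auto simp: ran_def)
    moreover have "strand_diagram Z \<mu>" using v(1) by (simp add: viable_moving_def)
    ultimately have "of_bool (y \<in> dom \<mu>) = (1::int)"
      using hclass_boundary[of Z \<mu> "fst x" j] viable_moving_lookup[OF v(1), of "(fst x, Suc j)"]
        viable_moving_lookup[OF v(1), of "(fst x, j)"]
      unfolding j by simp
    then have "y \<in> dom \<mu>" by (simp split: if_splits)
    then obtain y'' where y'': "\<mu>' y = Some y''" using d by auto
    have "x = y"
      by (rule viable_moving_covering_unique[OF v(2) x(2) _ _ _ y'', of "fst x" "snd y"])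
        (use xy less viable_moving_less[OF v(2) y''] in auto)
    with xy show False by simp
  qed
  show ?thesis
  proof
    fix x
    show "\<mu> x = \<mu>' x"
    proof (cases "x \<in> dom \<mu>")
      case True
      then obtain y y' where x: "\<mu> x = Some y" "\<mu>' x = Some y'" using d by blast
      have "snd y = snd y'"
        using not_less[OF v h d x] not_less[OF v(2,1) h[symmetric] d[symmetric] x(2,1)] by simp
      moreover have "fst y = fst y'"
        using viable_moving_less[OF v(1) x(1)] viable_moving_less[OF v(2) x(2)] by simp
      ultimately show ?thesis using x by (simp add: prod_eq_iff)
    next
      case False
      then show ?thesis using d by (metis domIff)
    qed
  qed
qed

section \<open>Cutting and joining strands at a place\<close>

text \<open>A strand is named by its starting point. The description is meaningful when some strand
  runs strictly past \<open>u\<close>; viability then makes it unique.\<close>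

definition passing_strand :: "point \<Rightarrow> strands \<Rightarrow> point" where
  "passing_strand u \<mu> = (THE x. \<exists>y. \<mu> x = Some y \<and> point_less x u \<and> point_less u y)"

text \<open>This is what resolving a crossing with a horizontal strand at \<open>u\<close> does to
  the moving strands: the passing strand now stops at \<open>u\<close>, and the horizontal strand
  becomes its continuation.\<close>

definition split_at :: "point \<Rightarrow> strands \<Rightarrow> strands" where
  "split_at u \<mu> = (let x = passing_strand u \<mu> in \<mu>(x := Some u, u := \<mu> x))"

lemma passing_strand_eq:
  assumes "viable_moving Z \<mu>" "\<mu> x = Some y" "point_less x u" "point_less u y"
  shows "passing_strand u \<mu> = x"
  unfolding passing_strand_def
proof (rule the_equality)
  show "\<exists>y. \<mu> x = Some y \<and> point_less x u \<and> point_less u y" using assms by auto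
next
  fix x' assume "\<exists>y. \<mu> x' = Some y \<and> point_less x' u \<and> point_less u y"
  then obtain y' where "\<mu> x' = Some y'" "point_less x' u" "point_less u y'" by blast
  with assms show "x' = x"
    using viable_moving_covering_unique[of Z \<mu> x' y' "fst u" "snd u" x y]
    by (auto simp: point_less_def)
qed

text \<open>Some strand covers the step following \<open>u\<close>; as none starts at
  \<open>u\<close>, it started earlier.\<close>

lemma passing_strand_exists:
  assumes "viable_moving Z \<mu>" "u \<notin> dom \<mu>" "Poly_Mapping.lookup (hclass \<mu>) u \<noteq> 0"
  obtains y where "\<mu> (passing_strand u \<mu>) = Some y"
    "point_less (passing_strand u \<mu>) u" "point_less u y"
proof -
  obtain x y where x: "\<mu> x = Some y" "fst x = fst u" "snd x \<le> snd u" "snd u < snd y"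
    using assms(3) viable_moving_finite[OF assms(1)] by (auto simp: lookup_hclass_neq_0_iff)
  have "x \<noteq> u" using x(1) assms(2) by auto
  with x have "snd x < snd u" by (metis le_neq_implies_less prod_eqI)
  with x viable_moving_less[OF assms(1) x(1)]
  have "point_less x u" "point_less u y" by (auto simp: point_less_def)
  then show ?thesis using passing_strand_eq[OF assms(1) x(1)] that x(1) by auto
qed

lemma passed_not_in_ran:
  assumes "viable_moving Z \<mu>" "u \<notin> dom \<mu>" "Poly_Mapping.lookup (hclass \<mu>) u \<noteq> 0"
  shows "u \<notin> ran \<mu>"
proof
  assume "u \<in> ran \<mu>"
  then obtain z where z: "\<mu> z = Some u" by (auto simp: ran_def)
  obtain y where y: "\<mu> (passing_strand u \<mu>) = Some y"
    "point_less (passing_strand u \<mu>) u" "point_less u y"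
    using passing_strand_exists[OF assms] .
  \<comment> \<open>Both strands cover the step \<open>snd u - 1\<close> just before
    \<open>u\<close>, one because it ends at \<open>u\<close> and the other because it runs past
    \<open>u\<close>.\<close>
  have "z = passing_strand u \<mu>"
    by (rule viable_moving_covering_unique[OF assms(1) z _ _ _ y(1), of "fst u" "snd u - 1"])
      (use viable_moving_less[OF assms(1) z] y in \<open>auto simp: point_less_def\<close>)
  then have "y = u" using y(1) z by (metis option.inject)
  with y(3) show False by (simp add: point_less_def)
qed

text \<open>A point strictly between the ends of a strand is neither the start nor the end of its
  interval.\<close>

lemma passed_in_places:
  assumes "viable_moving Z \<mu>" "u \<notin> dom \<mu>" "Poly_Mapping.lookup (hclass \<mu>) u \<noteq> 0"
  shows "u \<in> places Z"
proof -
  obtain y where y: "\<mu> (passing_strand u \<mu>) = Some y"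
    "point_less (passing_strand u \<mu>) u" "point_less u y"
    using passing_strand_exists[OF assms] .
  have "strand_diagram Z \<mu>" using assms by (simp add: viable_moving_def)
  from strand_diagram_points(2)[OF this y(1)] y show ?thesis
    by (cases u; cases y) (auto simp: points_def places_def point_less_def)
qed

text \<open>The class of a segment is additive under subdivision, and all other strands are
  untouched.\<close>

lemma hclass_upd_split:
  assumes "finite (dom \<mu>)" "\<mu> x = Some y" "point_less x u" "point_less u y" "u \<notin> dom \<mu>"
  shows "hclass (\<mu>(x := Some u, u := Some y)) = hclass \<mu>"
proof -
  have [simp]: "x \<noteq> u" using assms by auto
  have seg: "segment x y = segment x u + segment u y"
    using assms(3,4) unfolding segment_def point_less_def
    by (simp add: sum.atLeastLessThan_concat less_imp_le)
  have "hclass \<mu> = segment x y + (\<Sum>z\<in>dom \<mu> - {x}. segment z (the (\<mu> z)))"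
    unfolding hclass_def using assms by (subst sum.remove[of _ x]) auto
  moreover have "hclass (\<mu>(x := Some u, u := Some y))
      = segment u y + (segment x u + (\<Sum>z\<in>dom \<mu> - {x}. segment z (the (\<mu> z))))"
  proof -
    have d: "dom (\<mu>(x := Some u, u := Some y)) = insert u (insert x (dom \<mu> - {x}))" by auto
    have fin: "finite (insert x (dom \<mu> - {x}))" "finite (dom \<mu> - {x})" using assms(1) by auto
    have nin: "u \<notin> insert x (dom \<mu> - {x})" "x \<notin> dom \<mu> - {x}"
      using assms(2,5) by auto
    have "(\<Sum>z\<in>dom \<mu> - {x}. segment z (the ((\<mu>(x := Some u, u := Some y)) z)))
        = (\<Sum>z\<in>dom \<mu> - {x}. segment z (the (\<mu> z)))"
      using assms by (intro sum.cong) auto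
    then show ?thesis
      unfolding hclass_def d sum.insert[OF fin(1) nin(1)] sum.insert[OF fin(2) nin(2)] by simp
  qed
  ultimately show ?thesis using seg by (simp add: ac_simps)
qed

lemma split_at:
  assumes v: "viable_moving Z \<mu>" and u: "u \<notin> dom \<mu>" "Poly_Mapping.lookup (hclass \<mu>) u \<noteq> 0"
  shows viable_moving_split_at: "viable_moving Z (split_at u \<mu>)"
    and hclass_split_at: "hclass (split_at u \<mu>) = hclass \<mu>"
    and dom_split_at: "dom (split_at u \<mu>) = insert u (dom \<mu>)"
    and ran_split_at: "ran (split_at u \<mu>) = insert u (ran \<mu>)"
proof -
  let ?x = "passing_strand u \<mu>"
  obtain y where y: "\<mu> ?x = Some y" "point_less ?x u" "point_less u y"
    using passing_strand_exists[OF v u] .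
  have s: "split_at u \<mu> = \<mu>(?x := Some u, u := Some y)"
    using y by (simp add: split_at_def Let_def)
  have sd: "strand_diagram Z \<mu>" and nh: "no_horizontal \<mu>"
    using v by (auto simp: viable_moving_def)
  have ne: "?x \<noteq> u" "u \<noteq> y" using y by (auto simp: point_less_def)
  have nr: "u \<notin> ran \<mu>" by (rule passed_not_in_ran[OF v u])
  show h: "hclass (split_at u \<mu>) = hclass \<mu>"
    unfolding s by (rule hclass_upd_split[OF viable_moving_finite[OF v] y u(1)])
  show d: "dom (split_at u \<mu>) = insert u (dom \<mu>)" unfolding s using y by auto
  have inj: "\<mu> w = Some y \<Longrightarrow> w = ?x" for w by (rule strand_diagram_inj[OF sd _ y(1)])
  have nu: "\<mu> w \<noteq> Some u" for w using nr by (metis ranI)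
  \<comment> \<open>The complete graph after the cut: two new pieces and the old strands, whose ends
    differ from both \<open>u\<close> and \<open>y\<close>. Injectivity, the order condition and the
    absence of horizontal strands are all read off from this disjunction.\<close>
  have graph: "w = ?x \<and> z = u \<or> w = u \<and> z = y \<or> \<mu> w = Some z \<and> w \<noteq> ?x \<and> z \<noteq> u \<and> z \<noteq> y"
    if "split_at u \<mu> w = Some z" for w z
    using that nu[of w] inj[of w] by (auto simp: s split: if_splits)
  have r1: "z \<in> insert u (ran \<mu>)" if "split_at u \<mu> w = Some z" for w z
    using graph[OF that] y(1) by (auto intro: ranI)
  have r2: "z \<in> ran (split_at u \<mu>)" if z: "z \<in> insert u (ran \<mu>)" for z
  proof (cases "z = u \<or> z = y")
    case True
    have "split_at u \<mu> ?x = Some u" "split_at u \<mu> u = Some y" using ne by (auto simp: s)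
    with True show ?thesis by (auto simp: ran_def)
  next
    case False
    then obtain w where w: "\<mu> w = Some z" using z by (auto simp: ran_def)
    then have "w \<noteq> ?x" "w \<noteq> u" using False y u by auto
    with w have "split_at u \<mu> w = Some z" by (simp add: s)
    then show ?thesis by (auto simp: ran_def)
  qed
  show r: "ran (split_at u \<mu>) = insert u (ran \<mu>)"
  proof (intro equalityI subsetI r2)
    fix z assume "z \<in> ran (split_at u \<mu>)"
    then obtain w where "split_at u \<mu> w = Some z" by (auto simp: ran_def)
    then show "z \<in> insert u (ran \<mu>)" by (rule r1)
  qed
  have "u \<in> points Z" using passed_in_places[OF v u] places_subset_points by blast
  moreover have "inj_on (split_at u \<mu>) (dom (split_at u \<mu>))"
  proof (rule inj_onI)
    fix a b assume ab: "a \<in> dom (split_at u \<mu>)" "b \<in> dom (split_at u \<mu>)"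
      "split_at u \<mu> a = split_at u \<mu> b"
    then obtain c where c: "split_at u \<mu> a = Some c" "split_at u \<mu> b = Some c" by force
    show "a = b"
      using graph[OF c(1)] graph[OF c(2)] ne strand_diagram_inj[OF sd] by metis
  qed
  moreover have "point_le a b" if "split_at u \<mu> a = Some b" for a b
    using graph[OF that] y(2,3) sd by (auto simp: point_le_def point_less_def strand_diagram_def)
  moreover have "dom (split_at u \<mu>) \<subseteq> points Z" "ran (split_at u \<mu>) \<subseteq> points Z"
    unfolding d r using sd[unfolded strand_diagram_def] \<open>u \<in> points Z\<close> by blast+
  ultimately have "strand_diagram Z (split_at u \<mu>)"
    unfolding strand_diagram_def by blast
  moreover have "no_horizontal (split_at u \<mu>)"
    using graph nh ne unfolding no_horizontal_def by metis
  ultimately show "viable_moving Z (split_at u \<mu>)"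
    using v h by (auto simp: viable_moving_def)
qed

text \<open>\<open>join_at\<close> redirects whichever strand ends at \<open>p\<close>; by
  injectivity there is just one, so the operation is a finite update.\<close>

lemma join_at_eq:
  assumes "strand_diagram Z \<mu>" "\<mu> x = Some p" "x \<noteq> p"
  shows "join_at p \<mu> = \<mu>(p := None, x := \<mu> p)"
proof
  fix z
  have inj: "z = x" if "\<mu> z = Some p" using strand_diagram_inj[OF assms(1) that assms(2)] .
  show "join_at p \<mu> z = (\<mu>(p := None, x := \<mu> p)) z"
  proof (cases "z = x")
    case True
    then show ?thesis using assms(2,3) by (simp add: join_at_def)
  next
    case False
    then have "\<mu> z \<noteq> Some p" using inj by blast
    with False show ?thesis by (simp add: join_at_def)
  qed
qed

lemma join_at:
  assumes v: "viable_moving Z \<mu>" and p: "p \<in> dom \<mu>" "p \<in> ran \<mu>"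
  shows viable_moving_join_at: "viable_moving Z (join_at p \<mu>)"
    and hclass_join_at: "hclass (join_at p \<mu>) = hclass \<mu>"
    and dom_join_at: "dom (join_at p \<mu>) = dom \<mu> - {p}"
    and ran_join_at: "ran (join_at p \<mu>) = ran \<mu> - {p}"
proof -
  obtain x y where xy: "\<mu> x = Some p" "\<mu> p = Some y" using p by (auto simp: ran_def)
  note l = viable_moving_less[OF v xy(1)] viable_moving_less[OF v xy(2)]
  have ne: "x \<noteq> p" "y \<noteq> p" "x \<noteq> y" using l by auto
  have sd: "strand_diagram Z \<mu>" and nh: "no_horizontal \<mu>"
    using v by (auto simp: viable_moving_def)
  have j: "join_at p \<mu> = \<mu>(p := None, x := Some y)"
    using join_at_eq[OF sd xy(1) ne(1)] xy(2) by simp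
  show d: "dom (join_at p \<mu>) = dom \<mu> - {p}" using xy ne by (auto simp: j)
  have jx: "join_at p \<mu> x = Some y" by (simp add: j)
  \<comment> \<open>The class of the joined diagram is found backwards: subdividing the long strand
    at \<open>p\<close> does not change the class and restores \<open>\<mu>\<close>.\<close>
  have "hclass ((join_at p \<mu>)(x := Some p, p := Some y)) = hclass (join_at p \<mu>)"
    by (rule hclass_upd_split[where \<mu> = "join_at p \<mu>" and x = x and y = y, OF _ jx])
      (use viable_moving_finite[OF v] l d in \<open>auto simp: point_less_def\<close>)
  moreover have "(join_at p \<mu>)(x := Some p, p := Some y) = \<mu>"
    using xy ne by (auto simp: j fun_eq_iff)
  ultimately show h: "hclass (join_at p \<mu>) = hclass \<mu>" by simp
  have inj: "\<mu> w = Some p \<Longrightarrow> w = x" "\<mu> w = Some y \<Longrightarrow> w = p" for w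
    using strand_diagram_inj[OF sd] xy by blast+
  have graph: "w = x \<and> z = y \<or> \<mu> w = Some z \<and> w \<noteq> x \<and> w \<noteq> p \<and> z \<noteq> p \<and> z \<noteq> y"
    if "join_at p \<mu> w = Some z" for w z
    using that inj[of w] by (auto simp: j split: if_splits)
  have "z \<in> ran (join_at p \<mu>)" if z: "z \<in> ran \<mu>" "z \<noteq> p" for z
  proof (cases "z = y")
    case True
    with jx show ?thesis by (auto simp: ran_def)
  next
    case False
    obtain w where w: "\<mu> w = Some z" using z by (auto simp: ran_def)
    with False z xy have "join_at p \<mu> w = Some z" by (auto simp: j)
    then show ?thesis by (auto simp: ran_def)
  qed
  moreover have "z \<in> ran \<mu> - {p}" if "join_at p \<mu> w = Some z" for w z
    using graph[OF that] xy(2) ne by (auto intro: ranI)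
  ultimately show r: "ran (join_at p \<mu>) = ran \<mu> - {p}" unfolding ran_def by blast
  have "inj_on (join_at p \<mu>) (dom (join_at p \<mu>))"
  proof (rule inj_onI)
    fix a b assume ab: "a \<in> dom (join_at p \<mu>)" "b \<in> dom (join_at p \<mu>)"
      "join_at p \<mu> a = join_at p \<mu> b"
    then obtain c where c: "join_at p \<mu> a = Some c" "join_at p \<mu> b = Some c" by force
    show "a = b"
      using graph[OF c(1)] graph[OF c(2)] strand_diagram_inj[OF sd] by metis
  qed
  moreover have "point_le a b" if "join_at p \<mu> a = Some b" for a b
    using graph[OF that] l sd by (auto simp: point_le_def strand_diagram_def)
  moreover have "dom (join_at p \<mu>) \<subseteq> points Z" "ran (join_at p \<mu>) \<subseteq> points Z"
    unfolding d r using sd[unfolded strand_diagram_def] by blast+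
  ultimately have "strand_diagram Z (join_at p \<mu>)"
    unfolding strand_diagram_def by blast
  moreover have "no_horizontal (join_at p \<mu>)"
    using graph nh ne unfolding no_horizontal_def by metis
  ultimately show "viable_moving Z (join_at p \<mu>)"
    using v h by (auto simp: viable_moving_def)
qed

text \<open>Here and in the next two lemmas no strand is traced. Cutting and joining preserve
  \<open>hclass\<close> and insert or delete one point of the domain, so
  \<open>viable_moving_eqI\<close> leaves only an equality of sets.\<close>

lemma join_at_split_at:
  assumes "viable_moving Z \<mu>" "u \<notin> dom \<mu>" "Poly_Mapping.lookup (hclass \<mu>) u \<noteq> 0"
  shows "join_at u (split_at u \<mu>) = \<mu>"
proof -
  note s = split_at[OF assms]
  have "u \<in> dom (split_at u \<mu>)" "u \<in> ran (split_at u \<mu>)" unfolding s by blast+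
  note j = join_at[OF s(1) this]
  show ?thesis
  proof (rule viable_moving_eqI[OF j(1) assms(1)])
    show "hclass (join_at u (split_at u \<mu>)) = hclass \<mu>" by (simp only: j s)
    show "dom (join_at u (split_at u \<mu>)) = dom \<mu>" unfolding j s using assms(2) by blast
  qed
qed

lemma split_at_join_at:
  assumes "viable_moving Z \<mu>" "p \<in> dom \<mu>" "p \<in> ran \<mu>"
  shows "split_at p (join_at p \<mu>) = \<mu>"
proof -
  note j = join_at[OF assms]
  have "p \<notin> dom (join_at p \<mu>)" "Poly_Mapping.lookup (hclass (join_at p \<mu>)) p \<noteq> 0"
    using viable_moving_start[OF assms(1,2)] unfolding j by simp_all
  note s = split_at[OF j(1) this]
  show ?thesis
  proof (rule viable_moving_eqI[OF s(1) assms(1)])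
    show "hclass (split_at p (join_at p \<mu>)) = hclass \<mu>" by (simp only: j s)
    show "dom (split_at p (join_at p \<mu>)) = dom \<mu>" unfolding j s using assms(2) by blast
  qed
qed

lemma join_at_split_at_commute:
  assumes "viable_moving Z \<mu>" "p \<in> dom \<mu>" "p \<in> ran \<mu>"
    and u: "u \<notin> dom \<mu>" "Poly_Mapping.lookup (hclass \<mu>) u \<noteq> 0"
  shows "join_at p (split_at u \<mu>) = split_at u (join_at p \<mu>)"
proof -
  note j = join_at[OF assms(1-3)] and s = split_at[OF assms(1) u]
  have "p \<in> dom (split_at u \<mu>)" "p \<in> ran (split_at u \<mu>)"
    unfolding s using assms(2,3) by blast+
  note js = join_at[OF s(1) this]
  have "u \<notin> dom (join_at p \<mu>)" "Poly_Mapping.lookup (hclass (join_at p \<mu>)) u \<noteq> 0"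
    unfolding j using u by blast+
  note sj = split_at[OF j(1) this]
  show ?thesis
  proof (rule viable_moving_eqI[OF js(1) sj(1)])
    show "hclass (join_at p (split_at u \<mu>)) = hclass (split_at u (join_at p \<mu>))"
      by (simp only: j s js sj)
    show "dom (join_at p (split_at u \<mu>)) = dom (split_at u (join_at p \<mu>))"
      unfolding j s js sj using assms(2) u by blast
  qed
qed

section \<open>The terms of a diagram and its differential\<close>

text \<open>Products and differentials are sums over \<open>keys\<close>, so it matters that no
  terms cancel modulo 2; injectivity of \<open>f\<close> guarantees this.\<close>

lemma sum_keys_sum_basis:
  assumes "finite A" "inj_on f A"
  shows "Poly_Mapping.keys (\<Sum>a\<in>A. basis (f a)) = f ` A"
    and "(\<Sum>\<nu>\<in>Poly_Mapping.keys (\<Sum>a\<in>A. basis (f a)). g \<nu>) = (\<Sum>a\<in>A. g (f a))"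
proof -
  have "Poly_Mapping.lookup (\<Sum>a\<in>A. basis (f a)) \<nu> = of_bool (\<nu> \<in> f ` A)" for \<nu>
  proof -
    have "Poly_Mapping.lookup (\<Sum>a\<in>A. basis (f a)) \<nu> = (\<Sum>a\<in>A. if f a = \<nu> then 1 else 0)"
      by (simp add: lookup_sum basis_def lookup_single when_def)
    also have "\<dots> = (\<Sum>\<kappa>\<in>f ` A. if \<kappa> = \<nu> then 1 else 0)"
      by (simp add: sum.reindex[OF assms(2)])
    also have "\<dots> = of_bool (\<nu> \<in> f ` A)"
      using assms(1) by (simp add: sum.delta')
    finally show ?thesis .
  qed
  then show *: "Poly_Mapping.keys (\<Sum>a\<in>A. basis (f a)) = f ` A"
    by (auto simp: in_keys_iff)
  show "(\<Sum>\<nu>\<in>Poly_Mapping.keys (\<Sum>a\<in>A. basis (f a)). g \<nu>) = (\<Sum>a\<in>A. g (f a))"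
    unfolding * by (simp add: sum.reindex[OF assms(2)])
qed

section \<open>Identity diagrams and horizontal strands\<close>

lemma dom_identity_on [simp]: "dom (identity_on S) = S"
  by (auto simp: identity_on_def split: if_splits)

lemma ran_identity_on [simp]: "ran (identity_on S) = S"
  by (auto simp: identity_on_def ran_def)

lemma inj_identity_on: "inj_on identity_on A"
  by (rule inj_onI) (metis dom_identity_on)

lemma inversions_identity_on [simp]: "inversions (identity_on S) = 0"
proof -
  have "crossings (identity_on S) = {}"
    by (auto simp: crossings_def identity_on_def point_less_def split: if_splits)
  then show ?thesis by (simp add: inversions_def)
qed

text \<open>An identity diagram has no inversions, so the condition on inversion numbers always
  holds and only the matching of end points remains.\<close>

lemma strand_mult_identity_left:
  "strand_mult (identity_on S) \<phi> = (if S = dom \<phi> then basis \<phi> else 0)"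
proof -
  have "\<phi> \<circ>\<^sub>m identity_on (dom \<phi>) = \<phi>"
  proof
    fix x
    show "(\<phi> \<circ>\<^sub>m identity_on (dom \<phi>)) x = \<phi> x"
      by (cases "\<phi> x") (simp_all add: map_comp_def identity_on_def domIff)
  qed
  then show ?thesis by (auto simp: strand_mult_def)
qed

lemma strand_mult_identity_right:
  "strand_mult \<phi> (identity_on S) = (if S = ran \<phi> then basis \<phi> else 0)"
proof -
  have "identity_on (ran \<phi>) \<circ>\<^sub>m \<phi> = \<phi>"
  proof
    fix x
    show "(identity_on (ran \<phi>) \<circ>\<^sub>m \<phi>) x = \<phi> x"
      by (cases "\<phi> x") (simp_all add: map_comp_def identity_on_def ranI)
  qed
  then show ?thesis by (auto simp: strand_mult_def)
qed

lemma finite_sections: "finite (sections Z s)"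
  by (rule finite_subset[of _ "Pow (points Z)"]) (auto simp: sections_def finite_points)

lemma add_identity_on_apply: "(\<mu> ++ identity_on U) x = (if x \<in> U then Some x else \<mu> x)"
  by (simp add: map_add_def identity_on_def)

lemma dom_add_identity_on: "dom (\<mu> ++ identity_on U) = dom \<mu> \<union> U"
  by auto

lemma ran_add_identity_on:
  assumes "U \<inter> dom \<mu> = {}"
  shows "ran (\<mu> ++ identity_on U) = ran \<mu> \<union> U"
  using assms by (subst ran_map_add) auto

lemma inj_add_identity_on:
  assumes "\<And>U. U \<in> A \<Longrightarrow> U \<inter> dom \<mu> = {}"
  shows "inj_on (\<lambda>U. \<mu> ++ identity_on U) A"
proof (rule inj_onI)
  fix U V assume UV: "U \<in> A" "V \<in> A" "\<mu> ++ identity_on U = \<mu> ++ identity_on V"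
  then have "dom \<mu> \<union> U = dom \<mu> \<union> V" by (metis dom_add_identity_on)
  with assms[OF UV(1)] assms[OF UV(2)] show "U = V" by blast
qed

text \<open>Those sets of horizontal strands for which the filled diagram survives multiplication by
  both idempotents; they index the terms of \<open>mk_diagram\<close>.\<close>

definition horizontals :: "arc_diagram \<Rightarrow> nat set \<Rightarrow> strands \<Rightarrow> nat set \<Rightarrow> point set set" where
  "horizontals Z s \<mu> t = {U. U \<subseteq> points Z - (dom \<mu> \<union> ran \<mu>) \<and>
     dom \<mu> \<union> U \<in> sections Z s \<and> ran \<mu> \<union> U \<in> sections Z t}"

lemma finite_horizontals: "finite (horizontals Z s \<mu> t)"
  by (rule finite_subset[of _ "Pow (points Z)"]) (auto simp: horizontals_def finite_points)

lemma horizontals_disjoint: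
  assumes "U \<in> horizontals Z s \<mu> t"
  shows "U \<inter> dom \<mu> = {}" "U \<inter> ran \<mu> = {}" "finite U"
  using assms finite_subset[OF _ finite_points, of U Z] by (auto simp: horizontals_def)

lemma inj_horizontals: "inj_on (\<lambda>U. \<mu> ++ identity_on U) (horizontals Z s \<mu> t)"
  by (rule inj_add_identity_on) (rule horizontals_disjoint)

text \<open>Multiplication by an idempotent only filters terms: each term of \<open>fill\<close> has
  one domain and one range, so at most one section on each side matches it. The terms stay distinct
  because \<open>U\<close> can be read off from the domain.\<close>

lemma mk_diagram_eq:
  "mk_diagram Z s \<mu> t = (\<Sum>U\<in>horizontals Z s \<mu> t. basis (\<mu> ++ identity_on U))"
proof -
  let ?P = "Pow (points Z - (dom \<mu> \<union> ran \<mu>))"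
  let ?H = "{U \<in> ?P. dom \<mu> \<union> U \<in> sections Z s}"
  have finP: "finite ?P" by (simp add: finite_points)
  have injP: "inj_on (\<lambda>U. \<mu> ++ identity_on U) ?P" by (rule inj_add_identity_on) auto
  have injH: "inj_on (\<lambda>U. \<mu> ++ identity_on U) ?H" by (rule inj_on_subset[OF injP]) auto
  note keys = sum_keys_sum_basis(2)[OF finite_sections inj_identity_on]
  have "idem Z s \<odot> fill Z \<mu>
      = (\<Sum>S\<in>sections Z s. \<Sum>U\<in>?P. strand_mult (identity_on S) (\<mu> ++ identity_on U))"
    unfolding alg_mult_def idem_def fill_def keys sum_keys_sum_basis(2)[OF finP injP] ..
  also have "\<dots> = (\<Sum>U\<in>?P. \<Sum>S\<in>sections Z s.
      if S = dom \<mu> \<union> U then basis (\<mu> ++ identity_on U) else 0)"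
    by (subst sum.swap) (simp add: strand_mult_identity_left dom_add_identity_on Un_commute)
  also have "\<dots> = (\<Sum>U\<in>?P. if dom \<mu> \<union> U \<in> sections Z s then basis (\<mu> ++ identity_on U) else 0)"
    by (simp add: finite_sections)
  also have "\<dots> = (\<Sum>U\<in>?H. basis (\<mu> ++ identity_on U))"
    by (rule sum.inter_filter[symmetric]) (rule finP)
  finally have left: "idem Z s \<odot> fill Z \<mu> = (\<Sum>U\<in>?H. basis (\<mu> ++ identity_on U))" .
  have "mk_diagram Z s \<mu> t
      = (\<Sum>U\<in>?H. \<Sum>S\<in>sections Z t. strand_mult (\<mu> ++ identity_on U) (identity_on S))"
    unfolding mk_diagram_def left unfolding alg_mult_def idem_def keys
    by (subst sum_keys_sum_basis(2)[OF _ injH]) (use finP in auto)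
  also have "\<dots> = (\<Sum>U\<in>?H. if ran \<mu> \<union> U \<in> sections Z t then basis (\<mu> ++ identity_on U) else 0)"
  proof (rule sum.cong[OF refl])
    fix U assume "U \<in> ?H"
    then have "ran (\<mu> ++ identity_on U) = ran \<mu> \<union> U" by (intro ran_add_identity_on) auto
    then show "(\<Sum>S\<in>sections Z t. strand_mult (\<mu> ++ identity_on U) (identity_on S))
        = (if ran \<mu> \<union> U \<in> sections Z t then basis (\<mu> ++ identity_on U) else 0)"
      by (simp add: strand_mult_identity_right finite_sections)
  qed
  also have "\<dots> = (\<Sum>U\<in>{U \<in> ?H. ran \<mu> \<union> U \<in> sections Z t}. basis (\<mu> ++ identity_on U))"
    by (rule sum.inter_filter[symmetric]) (use finP in auto)
  also have "{U \<in> ?H. ran \<mu> \<union> U \<in> sections Z t} = horizontals Z s \<mu> t"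
    by (auto simp: horizontals_def)
  finally show ?thesis .
qed

lemma keys_mk_diagram:
  "Poly_Mapping.keys (mk_diagram Z s \<mu> t) = (\<lambda>U. \<mu> ++ identity_on U) ` horizontals Z s \<mu> t"
  unfolding mk_diagram_eq by (rule sum_keys_sum_basis(1)[OF finite_horizontals inj_horizontals])

lemma mk_diagram_neq_0_iff: "mk_diagram Z s \<mu> t \<noteq> 0 \<longleftrightarrow> horizontals Z s \<mu> t \<noteq> {}"
  using keys_mk_diagram[of Z s \<mu> t] by (metis image_is_empty keys_eq_empty)

section \<open>Crossings and the differential\<close>

text \<open>Two moving strands that cross would share a step, and two horizontal strands never
  cross. So each crossing is a horizontal strand at \<open>u\<close> met by the strand running past
  \<open>u\<close>. Since no moving strand starts at \<open>u\<close>, such a strand exists exactly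
  when the step after \<open>u\<close> is covered.\<close>

lemma crossings_add_identity_on:
  assumes v: "viable_moving Z \<mu>" and U: "U \<inter> dom \<mu> = {}"
  shows "crossings (\<mu> ++ identity_on U)
    = (\<lambda>u. (passing_strand u \<mu>, u)) ` {u \<in> U. Poly_Mapping.lookup (hclass \<mu>) u \<noteq> 0}"
    (is "?L = ?f ` ?R")
proof (intro equalityI subsetI)
  fix c assume "c \<in> ?L"
  then obtain x y where xy: "c = (x, y)" "x \<in> dom (\<mu> ++ identity_on U)"
    "y \<in> dom (\<mu> ++ identity_on U)" "point_less x y"
    "point_less (the ((\<mu> ++ identity_on U) y)) (the ((\<mu> ++ identity_on U) x))"
    unfolding crossings_def by (cases c) auto
  then obtain z w where zw: "(\<mu> ++ identity_on U) x = Some z" "(\<mu> ++ identity_on U) y = Some w"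
    by (meson domD)
  have c: "c = (x, y)" "(\<mu> ++ identity_on U) x = Some z" "(\<mu> ++ identity_on U) y = Some w"
    "point_less x y" "point_less w z"
    using xy zw by simp_all
  show "c \<in> ?f ` ?R"
  proof (cases "y \<in> U")
    case True
    with c have w: "w = y" by (simp add: add_identity_on_apply)
    have "x \<notin> U" using c w by (auto simp: add_identity_on_apply point_less_def)
    with c(2) have x: "\<mu> x = Some z" by (simp add: add_identity_on_apply)
    have "passing_strand y \<mu> = x" by (rule passing_strand_eq[OF v x]) (use c w in auto)
    moreover have "Poly_Mapping.lookup (hclass \<mu>) y \<noteq> 0"
      unfolding lookup_hclass_neq_0_iff[OF viable_moving_finite[OF v]]
      using x c(4,5) w by (intro exI[of _ x] exI[of _ z]) (auto simp: point_less_def)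
    ultimately show ?thesis using True c(1) by blast
  next
    case False
    \<comment> \<open>If the strand from \<open>y\<close> moves, the one from \<open>x\<close> has
      to end beyond its end. Then both cover the step following \<open>y\<close>, which viability
      forbids.\<close>
    with c(3) have y: "\<mu> y = Some w" by (simp add: add_identity_on_apply)
    note yw = viable_moving_less[OF v y]
    have "x \<notin> U"
      using c(2,4,5) yw by (auto simp: add_identity_on_apply point_less_def)
    with c(2) have x: "\<mu> x = Some z" by (simp add: add_identity_on_apply)
    have "x = y"
      by (rule viable_moving_covering_unique[OF v x _ _ _ y, of "fst y" "snd y"])
        (use c(4,5) yw in \<open>auto simp: point_less_def\<close>)
    with c(4) show ?thesis by (simp add: point_less_def)
  qed
next
  fix c assume "c \<in> ?f ` ?R"
  then obtain u where u: "u \<in> U" "Poly_Mapping.lookup (hclass \<mu>) u \<noteq> 0"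
    "c = (passing_strand u \<mu>, u)" by blast
  then have "u \<notin> dom \<mu>" using U by blast
  then obtain y where y: "\<mu> (passing_strand u \<mu>) = Some y"
    "point_less (passing_strand u \<mu>) u" "point_less u y"
    using passing_strand_exists[OF v _ u(2)] by blast
  then have "passing_strand u \<mu> \<notin> U" using U by blast
  with u y show "c \<in> ?L" by (simp add: crossings_def dom_def add_identity_on_apply)
qed

lemma inversions_add_identity_on:
  assumes "viable_moving Z \<mu>" "U \<inter> dom \<mu> = {}"
  shows "inversions (\<mu> ++ identity_on U) = card {u \<in> U. Poly_Mapping.lookup (hclass \<mu>) u \<noteq> 0}"
  unfolding inversions_def crossings_add_identity_on[OF assms]
  by (rule card_image) (auto intro: inj_onI)

lemma resolve_add_identity_on:
  assumes v: "viable_moving Z \<mu>" and U: "U \<inter> dom \<mu> = {}"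
    and u: "u \<in> U" "Poly_Mapping.lookup (hclass \<mu>) u \<noteq> 0"
  shows "resolve (\<mu> ++ identity_on U) (passing_strand u \<mu>, u)
    = split_at u \<mu> ++ identity_on (U - {u})"
proof
  fix z
  have "u \<notin> dom \<mu>" using u U by blast
  then obtain y where y: "\<mu> (passing_strand u \<mu>) = Some y"
    "point_less (passing_strand u \<mu>) u" "point_less u y"
    using passing_strand_exists[OF v _ u(2)] by blast
  then have "passing_strand u \<mu> \<notin> U" "passing_strand u \<mu> \<noteq> u"
    using U by (blast, auto simp: point_less_def)
  then show "resolve (\<mu> ++ identity_on U) (passing_strand u \<mu>, u) z
      = (split_at u \<mu> ++ identity_on (U - {u})) z"
    using u(1) by (simp add: resolve_def add_identity_on_apply split_at_def Let_def)
qed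

text \<open>Every resolution is admissible. Cutting at \<open>u\<close> preserves
  \<open>hclass\<close>, so the remaining horizontal strands keep their crossings and only the one
  at \<open>u\<close> disappears.\<close>

lemma strand_diff_add_identity_on:
  assumes v: "viable_moving Z \<mu>" and U: "U \<inter> dom \<mu> = {}" "finite U"
  shows "strand_diff (\<mu> ++ identity_on U)
    = (\<Sum>u\<in>{u \<in> U. Poly_Mapping.lookup (hclass \<mu>) u \<noteq> 0}.
        basis (split_at u \<mu> ++ identity_on (U - {u})))"
proof -
  let ?R = "{u \<in> U. Poly_Mapping.lookup (hclass \<mu>) u \<noteq> 0}"
  let ?\<nu> = "\<mu> ++ identity_on U"
  have inv: "inversions (resolve ?\<nu> (passing_strand u \<mu>, u)) + 1 = inversions ?\<nu>"
    if u: "u \<in> ?R" for u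
  proof -
    have u': "u \<in> U" "Poly_Mapping.lookup (hclass \<mu>) u \<noteq> 0" "u \<notin> dom \<mu>" using u U by auto
    note s = split_at[OF v u'(3,2)]
    have "(U - {u}) \<inter> dom (split_at u \<mu>) = {}" unfolding s using U by blast
    then have "inversions (resolve ?\<nu> (passing_strand u \<mu>, u))
        = card {w \<in> U - {u}. Poly_Mapping.lookup (hclass \<mu>) w \<noteq> 0}"
      by (simp only: resolve_add_identity_on[OF v U(1) u'(1,2)]
          inversions_add_identity_on[OF s(1)] s(2))
    also have "{w \<in> U - {u}. Poly_Mapping.lookup (hclass \<mu>) w \<noteq> 0} = ?R - {u}" by auto
    finally show ?thesis
      unfolding inversions_add_identity_on[OF v U(1)]
      using card_Suc_Diff1[of ?R u] u U(2) by simp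
  qed
  then have "{c \<in> crossings ?\<nu>. inversions (resolve ?\<nu> c) + 1 = inversions ?\<nu>}
      = (\<lambda>u. (passing_strand u \<mu>, u)) ` ?R"
    unfolding crossings_add_identity_on[OF v U(1)] by blast
  moreover have "inj_on (\<lambda>u. (passing_strand u \<mu>, u)) ?R" by (auto intro: inj_onI)
  ultimately have "strand_diff ?\<nu> = (\<Sum>u\<in>?R. basis (resolve ?\<nu> (passing_strand u \<mu>, u)))"
    unfolding strand_diff_def by (simp add: sum.reindex)
  also have "\<dots> = (\<Sum>u\<in>?R. basis (split_at u \<mu> ++ identity_on (U - {u})))"
    by (intro sum.cong) (auto simp: resolve_add_identity_on[OF v U(1)])
  finally show ?thesis .
qed

text \<open>The places at which the picture of a diagram has a crossing.\<close>

definition crossed :: "arc_diagram \<Rightarrow> nat set \<Rightarrow> strands \<Rightarrow> nat set \<Rightarrow> point set" where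
  "crossed Z s \<mu> t = {u. \<exists>U\<in>horizontals Z s \<mu> t. u \<in> U \<and> Poly_Mapping.lookup (hclass \<mu>) u \<noteq> 0}"

lemma finite_crossed: "finite (crossed Z s \<mu> t)"
  by (rule finite_subset[OF _ finite_points[of Z]]) (auto simp: crossed_def horizontals_def)

lemma crossed_not_in_dom: "u \<in> crossed Z s \<mu> t \<Longrightarrow> u \<notin> dom \<mu>"
  using horizontals_disjoint by (fastforce simp: crossed_def)

lemma crossed_lookup: "u \<in> crossed Z s \<mu> t \<Longrightarrow> Poly_Mapping.lookup (hclass \<mu>) u \<noteq> 0"
  by (auto simp: crossed_def)

text \<open>Cutting moves \<open>u\<close> from the horizontal strands into both the domain and the
  range of the moving part. The full domain and range are unchanged, hence so are the sections they
  have to match.\<close>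

lemma horizontals_split_at:
  assumes v: "viable_moving Z \<mu>" and u: "u \<notin> dom \<mu>" "Poly_Mapping.lookup (hclass \<mu>) u \<noteq> 0"
  shows "horizontals Z s (split_at u \<mu>) t = (\<lambda>U. U - {u}) ` {U \<in> horizontals Z s \<mu> t. u \<in> U}"
proof (intro equalityI subsetI)
  note sp = split_at[OF v u]
  have up: "u \<in> points Z" using passed_in_places[OF v u] places_subset_points by blast
  have ur: "u \<notin> ran \<mu>" by (rule passed_not_in_ran[OF v u])
  {
    fix U assume U: "U \<in> horizontals Z s (split_at u \<mu>) t"
    then have uU: "u \<notin> U" using horizontals_disjoint(1)[OF U] sp(3) by blast
    have "insert u U \<in> horizontals Z s \<mu> t"
      using U up u ur unfolding horizontals_def sp by auto
    then show "U \<in> (\<lambda>U. U - {u}) ` {U \<in> horizontals Z s \<mu> t. u \<in> U}"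
      using uU by (intro image_eqI[of _ _ "insert u U"]) auto
  next
    fix V assume "V \<in> (\<lambda>U. U - {u}) ` {U \<in> horizontals Z s \<mu> t. u \<in> U}"
    then obtain U where U: "U \<in> horizontals Z s \<mu> t" "u \<in> U" "V = U - {u}" by blast
    then have "insert u (dom \<mu>) \<union> V = dom \<mu> \<union> U" "insert u (ran \<mu>) \<union> V = ran \<mu> \<union> U" by auto
    with U show "V \<in> horizontals Z s (split_at u \<mu>) t"
      unfolding horizontals_def sp by auto
  }
qed

text \<open>The double sum over terms and their crossings is regrouped by the place \<open>u\<close>
  of the crossing. The terms with a horizontal strand at \<open>u\<close> are, after resolution,
  exactly the terms of the diagram cut at \<open>u\<close>.\<close>

lemma diff_mk_diagram:
  assumes v: "viable_moving Z \<mu>"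
  shows "diff (mk_diagram Z s \<mu> t) = (\<Sum>u\<in>crossed Z s \<mu> t. mk_diagram Z s (split_at u \<mu>) t)"
proof -
  let ?H = "horizontals Z s \<mu> t" and ?X = "crossed Z s \<mu> t"
  let ?b = "\<lambda>U u. basis (split_at u \<mu> ++ identity_on (U - {u}))"
  have "diff (mk_diagram Z s \<mu> t) = (\<Sum>U\<in>?H. strand_diff (\<mu> ++ identity_on U))"
    unfolding diff_def mk_diagram_eq
    by (rule sum_keys_sum_basis(2)[OF finite_horizontals inj_horizontals])
  also have "\<dots> = (\<Sum>U\<in>?H. \<Sum>u\<in>{u \<in> ?X. u \<in> U}. ?b U u)"
  proof (rule sum.cong[OF refl])
    fix U assume U: "U \<in> ?H"
    then have "{u \<in> U. Poly_Mapping.lookup (hclass \<mu>) u \<noteq> 0} = {u \<in> ?X. u \<in> U}"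
      by (auto simp: crossed_def)
    then show "strand_diff (\<mu> ++ identity_on U) = (\<Sum>u\<in>{u \<in> ?X. u \<in> U}. ?b U u)"
      using strand_diff_add_identity_on[OF v horizontals_disjoint(1,3)[OF U]] by simp
  qed
  also have "\<dots> = (\<Sum>u\<in>?X. \<Sum>U\<in>{U \<in> ?H. u \<in> U}. ?b U u)"
    by (rule sum.swap_restrict[OF finite_horizontals finite_crossed])
  also have "\<dots> = (\<Sum>u\<in>?X. mk_diagram Z s (split_at u \<mu>) t)"
  proof (rule sum.cong[OF refl])
    fix u assume u: "u \<in> ?X"
    have "inj_on (\<lambda>U. U - {u}) {U \<in> ?H. u \<in> U}" by (auto intro: inj_onI)
    then show "(\<Sum>U\<in>{U \<in> ?H. u \<in> U}. ?b U u) = mk_diagram Z s (split_at u \<mu>) t"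
      unfolding mk_diagram_eq
        horizontals_split_at[OF v crossed_not_in_dom[OF u] crossed_lookup[OF u]]
      by (simp add: sum.reindex)
  qed
  finally show ?thesis .
qed

section \<open>All-on once occupied pairs\<close>

text \<open>A section only has to represent each pair once, so the representing place may be
  exchanged for its partner. This is what allows a horizontal strand to change sides.\<close>

lemma sections_swap:
  assumes S: "S \<in> sections Z s" and a: "a \<in> S" "a \<in> places Z"
    and p: "p \<in> places Z" "matching Z p = matching Z a"
  shows "insert p (S - {a}) \<in> sections Z s"
proof -
  have S': "S \<subseteq> points Z" "matching Z ` (S \<inter> places Z) \<subseteq> s"
    "\<And>P. P \<in> s \<Longrightarrow> \<exists>!a. a \<in> S \<inter> places Z \<and> matching Z a = P"
    using S unfolding sections_def by simp_all
  have unique: "b = c" if "P \<in> s" "b \<in> S \<inter> places Z" "matching Z b = P"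
      "c \<in> S \<inter> places Z" "matching Z c = P" for P b c
    using S'(3)[OF that(1)] that(2-5) by (metis (no_types, lifting))
  have mem: "matching Z a \<in> s" using S'(2) a by blast
  have "\<exists>!b. b \<in> insert p (S - {a}) \<inter> places Z \<and> matching Z b = P" if P: "P \<in> s" for P
  proof (cases "P = matching Z a")
    case True
    show ?thesis
    proof (rule ex1I[of _ p])
      show "p \<in> insert p (S - {a}) \<inter> places Z \<and> matching Z p = P" using p True by blast
    next
      fix c assume c: "c \<in> insert p (S - {a}) \<inter> places Z \<and> matching Z c = P"
      show "c = p"
      proof (rule ccontr)
        assume "c \<noteq> p"
        with c have "c \<in> S \<inter> places Z" "c \<noteq> a" by blast+
        with unique[OF P, of c a] c a True[symmetric] show False by blast
      qed
    qed
  next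
    case False
    from S'(3)[OF P] obtain b where b: "b \<in> S \<inter> places Z" "matching Z b = P" by (metis (no_types, lifting))
    show ?thesis
    proof (rule ex1I[of _ b])
      show "b \<in> insert p (S - {a}) \<inter> places Z \<and> matching Z b = P" using b False by blast
    next
      fix c assume c: "c \<in> insert p (S - {a}) \<inter> places Z \<and> matching Z c = P"
      then have "c \<noteq> p" using False p(2) by auto
      then show "c = b" using c b unique[OF P, of c b] by blast
    qed
  qed
  moreover have "insert p (S - {a}) \<subseteq> points Z"
    using S'(1) p(1) places_subset_points by blast
  moreover have "matching Z ` (insert p (S - {a}) \<inter> places Z) \<subseteq> s"
    using S'(2) mem p(2) by auto
  ultimately show ?thesis unfolding sections_def by blast
qed

lemma all_on_once_occupiedD:
  assumes "all_on_once_occupied Z (h, s, t) P p"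
  shows "P \<in> s" "P \<in> t" "p \<in> places Z" "matching Z p = P"
    and "Poly_Mapping.lookup h (fst p, snd p - 1) = 1" "Poly_Mapping.lookup h p = 1"
    and "\<And>q. q \<in> places Z \<Longrightarrow> matching Z q = P \<Longrightarrow> Poly_Mapping.lookup h q \<noteq> 0 \<Longrightarrow> q = p"
proof -
  have *: "\<forall>q\<in>places Z. matching Z q = P \<and> q \<noteq> p \<longrightarrow> Poly_Mapping.lookup h q = 0"
    using assms unfolding all_on_once_occupied_def by simp
  show "\<And>q. q \<in> places Z \<Longrightarrow> matching Z q = P \<Longrightarrow> Poly_Mapping.lookup h q \<noteq> 0 \<Longrightarrow> q = p"
    using * by blast
qed (use assms in \<open>simp_all add: all_on_once_occupied_def\<close>)

text \<open>A second candidate would be covered by \<open>h\<close>, which is excluded for the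
  partner of \<open>p\<close>. This evaluates the choice of place in
  \<open>create_diagram\<close>.\<close>

lemma all_on_once_occupied_unique:
  assumes "all_on_once_occupied Z d P p"
  shows "(THE p. all_on_once_occupied Z d P p) = p"
proof (rule the_equality)
  obtain h s t where d: "d = (h, s, t)" by (cases d)
  fix q assume "all_on_once_occupied Z d P q"
  note q = all_on_once_occupiedD[OF this[unfolded d]]
  show "q = p"
    by (rule all_on_once_occupiedD(7)[OF assms[unfolded d] q(3,4)]) (simp add: q(6))
qed (rule assms)

text \<open>Both steps at \<open>p\<close> have multiplicity 1, so the boundary of the class
  vanishes at \<open>p\<close> and a start there has to be matched by an end.\<close>

lemma occupied_in_ran:
  assumes v: "viable_moving Z \<mu>" and p: "all_on_once_occupied Z (hclass \<mu>, s, t) P p" "p \<in> dom \<mu>"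
  shows "p \<in> ran \<mu>"
proof -
  note o = all_on_once_occupiedD[OF p(1)]
  obtain i j where ij: "p = (i, Suc j)"
    using o(3) by (cases p; cases "snd p") (auto simp: places_def)
  have "strand_diagram Z \<mu>" using v by (simp add: viable_moving_def)
  from hclass_boundary[OF this, of i j] o(5,6) p(2)
  have "of_bool (p \<in> ran \<mu>) = (1::int)" unfolding ij by simp
  then show ?thesis by (simp split: if_splits)
qed

text \<open>If the horizontal strand of the term lies at the other place of the pair, move it to \<open>p\<close>.\<close>

lemma occupied_swap:
  assumes v: "viable_moving Z \<mu>" and U: "U \<in> horizontals Z s \<mu> t"
    and o: "all_on_once_occupied Z (hclass \<mu>, s, t) P p" and p: "p \<notin> dom \<mu>"
  obtains V where "V \<in> horizontals Z s \<mu> t" "p \<in> V"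
    "\<And>u. u \<in> U \<Longrightarrow> Poly_Mapping.lookup (hclass \<mu>) u \<noteq> 0 \<Longrightarrow> u \<in> V"
proof (cases "p \<in> U")
  case True
  with U that show ?thesis by blast
next
  case False
  note o' = all_on_once_occupiedD[OF o]
  have U': "U \<subseteq> points Z - (dom \<mu> \<union> ran \<mu>)" "dom \<mu> \<union> U \<in> sections Z s" "ran \<mu> \<union> U \<in> sections Z t"
    using U unfolding horizontals_def by simp_all
  have "\<forall>Q\<in>s. \<exists>!a. a \<in> (dom \<mu> \<union> U) \<inter> places Z \<and> matching Z a = Q"
    using U'(2) unfolding sections_def by (elim CollectE conjE)
  from ex1_implies_ex[OF bspec[OF this o'(1)]]
  obtain a where a: "a \<in> dom \<mu> \<union> U" "a \<in> places Z" "matching Z a = P" by blast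
  have ap: "a \<noteq> p" using a(1) False p by blast
  then have a0: "Poly_Mapping.lookup (hclass \<mu>) a = 0" using o'(7)[OF a(2,3)] by blast
  then have ad: "a \<notin> dom \<mu>" using viable_moving_start[OF v, of a] by auto
  then have aU: "a \<in> U" using a(1) by blast
  then have ar: "a \<notin> ran \<mu>" using U'(1) by blast
  have pr: "p \<notin> ran \<mu>" by (rule passed_not_in_ran[OF v p]) (simp add: o'(6))
  let ?V = "insert p (U - {a})"
  have "insert p ((dom \<mu> \<union> U) - {a}) \<in> sections Z s" "insert p ((ran \<mu> \<union> U) - {a}) \<in> sections Z t"
    using sections_swap[OF U'(2) _ a(2) o'(3)] sections_swap[OF U'(3) _ a(2) o'(3)] aU a(3) o'(4)
    by simp_all
  moreover have "insert p ((dom \<mu> \<union> U) - {a}) = dom \<mu> \<union> ?V"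
    "insert p ((ran \<mu> \<union> U) - {a}) = ran \<mu> \<union> ?V"
    using ad ar by auto
  moreover have "?V \<subseteq> points Z - (dom \<mu> \<union> ran \<mu>)"
    using U'(1) p pr o'(3) places_subset_points by blast
  ultimately have "?V \<in> horizontals Z s \<mu> t" by (simp add: horizontals_def)
  moreover have "u \<in> ?V" if "u \<in> U" "Poly_Mapping.lookup (hclass \<mu>) u \<noteq> 0" for u
    using that a0 by auto
  ultimately show ?thesis using that by blast
qed

text \<open>Crossings occur only at horizontal strands on covered places, and \<open>p\<close> is
  the only covered place of the pair. Conversely, if no strand starts at \<open>p\<close>, one runs
  past it, and some term has its horizontal strand of the pair at \<open>p\<close>.\<close>

lemma crossing_at_occupied_iff:
  assumes v: "viable_moving Z \<mu>" and ne: "horizontals Z s \<mu> t \<noteq> {}"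
    and o: "all_on_once_occupied Z (hclass \<mu>, s, t) P p"
  shows "crossing_at Z P (mk_diagram Z s \<mu> t) \<longleftrightarrow> p \<notin> dom \<mu>"
proof
  note o' = all_on_once_occupiedD[OF o]
  assume "crossing_at Z P (mk_diagram Z s \<mu> t)"
  then obtain \<nu> c where \<nu>: "\<nu> \<in> Poly_Mapping.keys (mk_diagram Z s \<mu> t)" and c: "c \<in> crossings \<nu>"
    "case c of (x, y) \<Rightarrow> \<exists>a\<in>{x, y}. \<nu> a = Some a \<and> a \<in> places Z \<and> matching Z a = P"
    unfolding crossing_at_def by (elim bexE)
  obtain U where U: "U \<in> horizontals Z s \<mu> t" and \<nu>_eq: "\<nu> = \<mu> ++ identity_on U"
    using \<nu> unfolding keys_mk_diagram by (elim imageE)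
  obtain x y where xy': "c = (x, y)" by (cases c)
  then have xy: "(x, y) \<in> crossings (\<mu> ++ identity_on U)" using c \<nu>_eq by simp
  obtain a where a: "a \<in> {x, y}" "(\<mu> ++ identity_on U) a = Some a" "a \<in> places Z" "matching Z a = P"
    using c(2) unfolding xy' \<nu>_eq prod.case by (elim bexE conjE)
  note disj = horizontals_disjoint(1)[OF U]
  have y: "x = passing_strand y \<mu>" "y \<in> U" "Poly_Mapping.lookup (hclass \<mu>) y \<noteq> 0"
    using xy unfolding crossings_add_identity_on[OF v disj] by auto
  have yd: "y \<notin> dom \<mu>" using y(2) disj by blast
  obtain z where z: "\<mu> x = Some z" using passing_strand_exists[OF v yd y(3)] y(1) by blast
  \<comment> \<open>\<open>crossing_at\<close> allows either strand of the crossing to be the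
    horizontal one. The strand from \<open>x\<close> moves, so it has to be the one at
    \<open>y\<close>.\<close>
  have "a \<noteq> x"
  proof
    assume ax: "a = x"
    have "x \<notin> U" using z disj by blast
    then have "\<mu> x = Some x" using a(2) ax by (simp add: add_identity_on_apply)
    then show False using v unfolding viable_moving_def no_horizontal_def by blast
  qed
  then have "a = y" using a(1) by blast
  then have "y = p" using o'(7) a(3,4) y(3) by blast
  with yd show "p \<notin> dom \<mu>" by simp
next
  note o' = all_on_once_occupiedD[OF o]
  assume p: "p \<notin> dom \<mu>"
  obtain U where U: "U \<in> horizontals Z s \<mu> t" using ne by blast
  obtain V where V: "V \<in> horizontals Z s \<mu> t" "p \<in> V"
    using occupied_swap[OF v U o p] by blast
  have "(passing_strand p \<mu>, p) \<in> crossings (\<mu> ++ identity_on V)"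
    unfolding crossings_add_identity_on[OF v horizontals_disjoint(1)[OF V(1)]]
    using V(2) o'(6) by simp
  moreover have "(\<mu> ++ identity_on V) p = Some p" using V(2) by (simp add: add_identity_on_apply)
  ultimately show "crossing_at Z P (mk_diagram Z s \<mu> t)"
    unfolding crossing_at_def keys_mk_diagram
    using V(1) o'(3,4) by (intro bexI[of _ "\<mu> ++ identity_on V"] bexI[of _ "(passing_strand p \<mu>, p)"]) auto
qed

lemma occupied_crossed:
  assumes v: "viable_moving Z \<mu>" and ne: "horizontals Z s \<mu> t \<noteq> {}"
    and o: "all_on_once_occupied Z (hclass \<mu>, s, t) P p" and p: "p \<notin> dom \<mu>"
  shows "p \<in> crossed Z s \<mu> t"
proof -
  obtain U where U: "U \<in> horizontals Z s \<mu> t" using ne by blast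
  obtain V where "V \<in> horizontals Z s \<mu> t" "p \<in> V"
    using occupied_swap[OF v U o p] by blast
  then show ?thesis using all_on_once_occupiedD(6)[OF o] by (auto simp: crossed_def)
qed

lemma horizontals_join_at:
  assumes "viable_moving Z \<mu>" "p \<in> dom \<mu>" "p \<in> ran \<mu>"
  shows "horizontals Z s \<mu> t = (\<lambda>U. U - {p}) ` {U \<in> horizontals Z s (join_at p \<mu>) t. p \<in> U}"
proof -
  note j = join_at[OF assms]
  have "p \<notin> dom (join_at p \<mu>)" "Poly_Mapping.lookup (hclass (join_at p \<mu>)) p \<noteq> 0"
    using viable_moving_start[OF assms(1,2)] unfolding j by simp_all
  from horizontals_split_at[OF j(1) this] show ?thesis
    unfolding split_at_join_at[OF assms] .
qed

text \<open>Only those terms of the joined diagram with a horizontal strand at \<open>p\<close> come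
  from terms of \<open>\<mu>\<close>. A crossing at \<open>u\<close> might be witnessed by a term
  using the partner of \<open>p\<close> instead; moving that horizontal strand to \<open>p\<close>
  gives a witness for the same \<open>u\<close> that does come from \<open>\<mu>\<close>.\<close>

lemma crossed_join_at:
  assumes v: "viable_moving Z \<mu>" and ne: "horizontals Z s \<mu> t \<noteq> {}"
    and o: "all_on_once_occupied Z (hclass \<mu>, s, t) P p" and p: "p \<in> dom \<mu>"
  shows "crossed Z s (join_at p \<mu>) t = insert p (crossed Z s \<mu> t)"
proof -
  have pr: "p \<in> ran \<mu>" by (rule occupied_in_ran[OF v o p])
  note j = join_at[OF v p pr] and H = horizontals_join_at[OF v p pr, of s t]
  have o': "all_on_once_occupied Z (hclass (join_at p \<mu>), s, t) P p" unfolding j by (rule o)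
  have pd: "p \<notin> dom (join_at p \<mu>)" unfolding j by blast
  have ne': "horizontals Z s (join_at p \<mu>) t \<noteq> {}" using ne unfolding H by blast
  show ?thesis
  proof (intro equalityI subsetI)
    fix u assume "u \<in> crossed Z s (join_at p \<mu>) t"
    then obtain U where U: "U \<in> horizontals Z s (join_at p \<mu>) t" "u \<in> U"
      "Poly_Mapping.lookup (hclass \<mu>) u \<noteq> 0" unfolding crossed_def j by blast
    obtain V where V: "V \<in> horizontals Z s (join_at p \<mu>) t" "p \<in> V" "u \<in> V"
      using occupied_swap[OF j(1) U(1) o' pd] U(2,3) unfolding j by metis
    then have "V - {p} \<in> horizontals Z s \<mu> t" unfolding H by blast
    moreover have "u \<in> V - {p}" if "u \<noteq> p" using V(3) that by blast
    ultimately have "u \<in> crossed Z s \<mu> t" if "u \<noteq> p"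
      unfolding crossed_def mem_Collect_eq using U(3) that by (intro bexI[of _ "V - {p}"] conjI)
    then show "u \<in> insert p (crossed Z s \<mu> t)" by blast
  next
    fix u assume "u \<in> insert p (crossed Z s \<mu> t)"
    then consider "u = p" | "u \<in> crossed Z s \<mu> t" by blast
    then show "u \<in> crossed Z s (join_at p \<mu>) t"
    proof cases
      case 1
      then show ?thesis using occupied_crossed[OF j(1) ne' o' pd] by simp
    next
      case 2
      then obtain U where U: "U \<in> horizontals Z s \<mu> t" "u \<in> U"
        "Poly_Mapping.lookup (hclass \<mu>) u \<noteq> 0" unfolding crossed_def by blast
      then obtain V where "V \<in> horizontals Z s (join_at p \<mu>) t" "u \<in> V"
        unfolding H by (elim imageE CollectE conjE) blast
      with U(3) show ?thesis
        unfolding crossed_def j mem_Collect_eq by (intro bexI[of _ V] conjI)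
    qed
  qed
qed

section \<open>The Maslov grading of viable diagrams\<close>

lemma hclass_add_identity_on:
  assumes "finite (dom \<mu>)" "finite U" "U \<inter> dom \<mu> = {}"
  shows "hclass (\<mu> ++ identity_on U) = hclass \<mu>"
proof -
  let ?\<nu> = "\<mu> ++ identity_on U"
  have "hclass ?\<nu> = (\<Sum>x\<in>dom \<mu>. segment x (the (?\<nu> x))) + (\<Sum>x\<in>U. segment x (the (?\<nu> x)))"
    unfolding hclass_def dom_add_identity_on
    by (rule sum.union_disjoint) (use assms in auto)
  also have "(\<Sum>x\<in>U. segment x (the (?\<nu> x))) = 0"
    by (rule sum.neutral) (simp add: add_identity_on_apply segment_def)
  also have "(\<Sum>x\<in>dom \<mu>. segment x (the (?\<nu> x))) = hclass \<mu>"
    unfolding hclass_def by (rule sum.cong) (use assms in \<open>auto simp: add_identity_on_apply\<close>)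
  finally show ?thesis by simp
qed

text \<open>The summand of the correction term in \<open>strand_maslov\<close>. The truncated
  \<open>j - 1\<close> is exact at places, where \<open>j\<close> is positive.\<close>

definition average_multiplicity :: "homology_class \<Rightarrow> point \<Rightarrow> rat" where
  "average_multiplicity h = (\<lambda>(i, j).
     of_int (Poly_Mapping.lookup h (i, j - 1) + Poly_Mapping.lookup h (i, j)) / 2)"

text \<open>A horizontal strand adds a crossing exactly where it also adds \<open>1\<close> to the correction term.\<close>

lemma strand_maslov_add_identity_on:
  assumes v: "viable_moving Z \<mu>" and U: "U \<in> horizontals Z s \<mu> t"
  shows "strand_maslov Z (\<mu> ++ identity_on U)
    = - (\<Sum>x\<in>dom \<mu> \<inter> places Z. average_multiplicity (hclass \<mu>) x)"
proof -
  let ?av = "average_multiplicity (hclass \<mu>)" and ?h = "Poly_Mapping.lookup (hclass \<mu>)"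
  note disj = horizontals_disjoint[OF U]
  have fin: "finite (dom \<mu>)" by (rule viable_moving_finite[OF v])
  have sd: "strand_diagram Z \<mu>" using v by (simp add: viable_moving_def)
  have av: "?av u = (if ?h u \<noteq> 0 then 1 else 0)" if u: "u \<in> U \<inter> places Z" for u
  proof -
    obtain i j where ij: "u = (i, Suc j)"
      using u by (cases u; cases "snd u") (auto simp: places_def)
    have "u \<notin> dom \<mu>" "u \<notin> ran \<mu>" using u disj by blast+
    then have "?h (i, Suc j) = ?h (i, j)" using hclass_boundary[OF sd, of i j] unfolding ij by simp
    then show ?thesis
      using viable_moving_lookup[OF v, of u] unfolding ij average_multiplicity_def by auto
  qed
  have "(\<Sum>x\<in>U \<inter> places Z. ?av x) = (\<Sum>x\<in>U \<inter> places Z. if ?h x \<noteq> 0 then 1 else 0)"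
    by (rule sum.cong[OF refl av])
  also have "\<dots> = of_nat (card {x \<in> U \<inter> places Z. ?h x \<noteq> 0})"
    using disj(3) by (simp add: sum.If_cases Int_def)
  also have "{x \<in> U \<inter> places Z. ?h x \<noteq> 0} = {x \<in> U. ?h x \<noteq> 0}"
    using passed_in_places[OF v] disj(1) by blast
  finally have U_sum: "(\<Sum>x\<in>U \<inter> places Z. ?av x) = of_nat (inversions (\<mu> ++ identity_on U))"
    unfolding inversions_add_identity_on[OF v disj(1)] .
  have "(dom \<mu> \<union> U) \<inter> places Z = (dom \<mu> \<inter> places Z) \<union> (U \<inter> places Z)" by blast
  then have "(\<Sum>x\<in>(dom \<mu> \<union> U) \<inter> places Z. ?av x)
      = (\<Sum>x\<in>dom \<mu> \<inter> places Z. ?av x) + (\<Sum>x\<in>U \<inter> places Z. ?av x)"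
    by (simp only:) (rule sum.union_disjoint, use fin disj in auto)
  then show ?thesis
    unfolding strand_maslov_def hclass_add_identity_on[OF fin disj(3,1)] dom_add_identity_on
      average_multiplicity_def[symmetric] U_sum by simp
qed

text \<open>The value computed for a single term does not involve \<open>U\<close>, so the arbitrary
  choice of a term in \<open>maslov\<close> is harmless.\<close>

lemma maslov_mk_diagram:
  assumes v: "viable_moving Z \<mu>" and ne: "horizontals Z s \<mu> t \<noteq> {}"
  shows "maslov Z (mk_diagram Z s \<mu> t)
    = - (\<Sum>x\<in>dom \<mu> \<inter> places Z. average_multiplicity (hclass \<mu>) x)"
proof -
  let ?K = "Poly_Mapping.keys (mk_diagram Z s \<mu> t)"
  have "?K \<noteq> {}" using ne unfolding keys_mk_diagram by simp
  then have "(SOME \<nu>. \<nu> \<in> ?K) \<in> ?K" by (rule some_in_eq[THEN iffD2])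
  then obtain U where "U \<in> horizontals Z s \<mu> t" "(SOME \<nu>. \<nu> \<in> ?K) = \<mu> ++ identity_on U"
    unfolding keys_mk_diagram by blast
  then show ?thesis unfolding maslov_def using strand_maslov_add_identity_on[OF v] by simp
qed

text \<open>Joining removes \<open>p\<close> from the domain and with it a summand of the correction
  term. This summand is 1 because both steps at \<open>p\<close> have multiplicity 1.\<close>

lemma maslov_join_at:
  assumes v: "viable_moving Z \<mu>" and ne: "horizontals Z s \<mu> t \<noteq> {}"
    and o: "all_on_once_occupied Z (hclass \<mu>, s, t) P p" and p: "p \<in> dom \<mu>"
  shows "maslov Z (mk_diagram Z s (join_at p \<mu>) t) = maslov Z (mk_diagram Z s \<mu> t) + 1"
proof -
  let ?av = "average_multiplicity (hclass \<mu>)"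
  note o' = all_on_once_occupiedD[OF o]
  have pr: "p \<in> ran \<mu>" by (rule occupied_in_ran[OF v o p])
  note j = join_at[OF v p pr]
  have ne': "horizontals Z s (join_at p \<mu>) t \<noteq> {}"
    using ne unfolding horizontals_join_at[OF v p pr, of s t] by blast
  have "(\<Sum>x\<in>dom \<mu> \<inter> places Z. ?av x) = ?av p + (\<Sum>x\<in>dom \<mu> \<inter> places Z - {p}. ?av x)"
    by (rule sum.remove) (use viable_moving_finite[OF v] p o'(3) in auto)
  moreover have "?av p = 1"
    using o'(5,6) by (cases p) (simp add: average_multiplicity_def)
  moreover have "dom \<mu> \<inter> places Z - {p} = (dom \<mu> - {p}) \<inter> places Z" by blast
  ultimately show ?thesis
    unfolding maslov_mk_diagram[OF v ne] maslov_mk_diagram[OF j(1) ne'] j by simp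
qed

section \<open>Linear algebra over the diagrams\<close>

lemma alg_add_self [simp]: "x + x = (0 :: 'a \<Rightarrow>\<^sub>0 bit)"
  by (rule poly_mapping_eqI) (simp add: lookup_add)

lemma F2_span_image:
  assumes "Vector_Spaces.linear scale2 scale2 f" "\<And>b. b \<in> B \<Longrightarrow> f b \<in> F2.span B'" "x \<in> F2.span B"
  shows "f x \<in> F2.span B'"
proof -
  have "f ` F2.span B = F2.span (f ` B)" using F2_pair.linear_span_image[OF assms(1)] by simp
  also have "\<dots> \<subseteq> F2.span B'" by (rule F2.span_minimal) (use assms(2) F2.subspace_span in auto)
  finally show ?thesis using assms(3) by blast
qed

text \<open>The expansions of \<open>x\<close> in \<open>A\<close> and in \<open>B\<close> are both
  its unique expansion in \<open>A \<union> B\<close>, so only common vectors have nonzero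
  coefficients. This localizes the grading statements to single diagrams.\<close>

lemma F2_span_Int:
  assumes "F2.independent (A \<union> B)"
  shows "F2.span A \<inter> F2.span B \<subseteq> F2.span (A \<inter> B)"
proof
  fix x assume "x \<in> F2.span A \<inter> F2.span B"
  then have x: "x \<in> F2.span A" "x \<in> F2.span B" by simp_all
  let ?r = "F2.representation (A \<union> B) x"
  have "?r = F2.representation A x" "?r = F2.representation B x"
    using F2.representation_extend[OF assms x(1)] F2.representation_extend[OF assms x(2)] by simp_all
  then have mem: "b \<in> A \<inter> B" if "?r b \<noteq> 0" for b
    using that F2.representation_ne_zero[of A x b] F2.representation_ne_zero[of B x b] by simp
  have "x \<in> F2.span (A \<union> B)" using F2.span_mono[of A "A \<union> B"] x(1) by blast
  then have "x = (\<Sum>b | ?r b \<noteq> 0. scale2 (?r b) b)"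
    using F2.sum_nonzero_representation_eq[OF assms] by simp
  also have "\<dots> \<in> F2.span (A \<inter> B)"
    by (intro F2.span_sum F2.span_scale F2.span_base mem) simp
  finally show "x \<in> F2.span (A \<inter> B)" .
qed

lemma independent_disjoint_keys:
  assumes ne: "0 \<notin> B"
    and disj: "\<And>x y. x \<in> B \<Longrightarrow> y \<in> B \<Longrightarrow> x \<noteq> y \<Longrightarrow> Poly_Mapping.keys x \<inter> Poly_Mapping.keys y = {}"
  shows "F2.independent (B :: ('a \<Rightarrow>\<^sub>0 bit) set)"
proof
  assume "F2.dependent B"
  then obtain b where b: "b \<in> B" "b \<in> F2.span (B - {b})" by (auto simp: F2.dependent_def)
  \<comment> \<open>The vectors vanishing on the support of \<open>b\<close> form a subspace, and it
    contains every other element of \<open>B\<close>.\<close>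
  have "\<forall>k\<in>Poly_Mapping.keys b. Poly_Mapping.lookup y k = 0" if "y \<in> F2.span (B - {b})" for y
    using that
  proof (induction rule: F2.span_induct)
    case base
    show ?case
      by (auto intro!: F2.subspaceI simp: lookup_add lookup_scale2)
  next
    case (step y)
    then have "Poly_Mapping.keys b \<inter> Poly_Mapping.keys y = {}" using disj b(1) by auto
    then show ?case by (auto simp: in_keys_iff)
  qed
  from this[OF b(2)] have "Poly_Mapping.keys b = {}" by (metis in_keys_iff equals0I)
  then have "b = 0" by (metis keys_eq_empty)
  with b(1) ne show False by simp
qed

text \<open>The support of a sum is not the union of the supports. Summing with coefficients over a
  common finite set makes the linearity of \<open>diff\<close> visible.\<close>

lemma diff_eq_sum:
  assumes "finite S" "Poly_Mapping.keys x \<subseteq> S"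
  shows "diff x = (\<Sum>\<nu>\<in>S. scale2 (Poly_Mapping.lookup x \<nu>) (strand_diff \<nu>))"
proof -
  have "scale2 (Poly_Mapping.lookup x \<nu>) (strand_diff \<nu>) = strand_diff \<nu>"
    if "\<nu> \<in> Poly_Mapping.keys x" for \<nu>
  proof -
    have "Poly_Mapping.lookup x \<nu> = 1" using that by (cases "Poly_Mapping.lookup x \<nu>") (auto simp: in_keys_iff)
    then show ?thesis by simp
  qed
  then have "diff x = (\<Sum>\<nu>\<in>Poly_Mapping.keys x. scale2 (Poly_Mapping.lookup x \<nu>) (strand_diff \<nu>))"
    unfolding diff_def by (intro sum.cong) auto
  also have "\<dots> = (\<Sum>\<nu>\<in>S. scale2 (Poly_Mapping.lookup x \<nu>) (strand_diff \<nu>))"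
    by (rule sum.mono_neutral_left) (use assms in \<open>auto simp: in_keys_iff\<close>)
  finally show ?thesis .
qed

lemma linear_diff: "Vector_Spaces.linear scale2 scale2 diff"
proof (rule Vector_Spaces.linear_iff[THEN iffD2], intro conjI allI)
  show "vector_space (scale2 :: bit \<Rightarrow> alg \<Rightarrow> alg)" by unfold_locales
  show "vector_space (scale2 :: bit \<Rightarrow> alg \<Rightarrow> alg)" by unfold_locales
  fix x y :: alg
  let ?S = "Poly_Mapping.keys x \<union> Poly_Mapping.keys y"
  have "Poly_Mapping.keys (x + y) \<subseteq> ?S" by (rule Poly_Mapping.keys_add)
  then show "diff (x + y) = diff x + diff y"
    using diff_eq_sum[of ?S "x + y"] diff_eq_sum[of ?S x] diff_eq_sum[of ?S y]
    by (simp add: lookup_add F2.scale_left_distrib sum.distrib del: add_bit_eq_xor)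
next
  fix c :: bit and x :: alg
  show "diff (scale2 c x) = scale2 c (diff x)"
    by (cases c) (simp_all add: diff_def)
qed

section \<open>Recovering a diagram from one of its terms\<close>

lemma moving_add_identity_on:
  assumes "no_horizontal \<mu>" "U \<inter> dom \<mu> = {}"
  shows "(\<lambda>x. if (\<mu> ++ identity_on U) x = Some x then None else (\<mu> ++ identity_on U) x) = \<mu>"
proof
  fix x
  show "(if (\<mu> ++ identity_on U) x = Some x then None else (\<mu> ++ identity_on U) x) = \<mu> x"
    using assms disjoint_iff[of U "dom \<mu>"]
    by (cases "x \<in> U") (simp_all add: add_identity_on_apply no_horizontal_def domIff)
qed

lemma sections_matching_image:
  assumes "S \<in> sections Z s"
  shows "matching Z ` (S \<inter> places Z) = s"
proof (intro equalityI subsetI)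
  fix P assume P: "P \<in> s"
  have "\<forall>Q\<in>s. \<exists>!a. a \<in> S \<inter> places Z \<and> matching Z a = Q"
    using assms unfolding sections_def by (elim CollectE conjE)
  from ex1_implies_ex[OF bspec[OF this P]] show "P \<in> matching Z ` (S \<inter> places Z)"
    by (elim exE conjE) (rule image_eqI, rule sym)
qed (use assms in \<open>auto simp: sections_def\<close>)

text \<open>Deleting the fixed points of a term leaves the moving strands, and the pairs met by its
  domain and range are \<open>s\<close> and \<open>t\<close>. Hence both the uniqueness of
  presentations and the disjointness of the supports of different diagrams.\<close>

lemma presents_key:
  assumes "presents Z (s, \<mu>, t) D" "\<nu> \<in> Poly_Mapping.keys D"
  shows "(s, \<mu>, t) = (matching Z ` (dom \<nu> \<inter> places Z),
    (\<lambda>x. if \<nu> x = Some x then None else \<nu> x), matching Z ` (ran \<nu> \<inter> places Z))"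
proof -
  have D: "D = mk_diagram Z s \<mu> t" "no_horizontal \<mu>" using assms(1) by (auto simp: presents_def)
  obtain U where U: "U \<in> horizontals Z s \<mu> t" "\<nu> = \<mu> ++ identity_on U"
    using assms(2) unfolding D keys_mk_diagram by (elim imageE)
  note disj = horizontals_disjoint[OF U(1)]
  have "dom \<mu> \<union> U \<in> sections Z s" "ran \<mu> \<union> U \<in> sections Z t"
    using U(1) unfolding horizontals_def by simp_all
  then show ?thesis
    unfolding U(2) moving_add_identity_on[OF D(2) disj(1)] dom_add_identity_on
      ran_add_identity_on[OF disj(1)] by (simp add: sections_matching_image)
qed

lemma presents_unique:
  assumes "presents Z d D" "presents Z d' D"
  shows "d = d'"
proof -
  obtain s \<mu> t s' \<mu>' t' where d: "d = (s, \<mu>, t)" "d' = (s', \<mu>', t')" by (cases d; cases d')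
  have "D \<noteq> 0" using assms(1) by (auto simp: presents_def d)
  then obtain \<nu> where "\<nu> \<in> Poly_Mapping.keys D" by (metis all_not_in_conv keys_eq_empty)
  then show ?thesis using presents_key[OF assms(1)[unfolded d]] presents_key[OF assms(2)[unfolded d]]
    unfolding d by simp
qed

lemma independent_diagrams: "F2.independent (diagrams Z)"
proof (rule independent_disjoint_keys)
  show "0 \<notin> diagrams Z" by (auto simp: diagrams_def presents_def)
  fix D E assume "D \<in> diagrams Z" "E \<in> diagrams Z" and ne: "D \<noteq> E"
  then obtain s \<mu> t s' \<mu>' t' where p: "presents Z (s, \<mu>, t) D" "presents Z (s', \<mu>', t') E"
    by (auto simp: diagrams_def)
  show "Poly_Mapping.keys D \<inter> Poly_Mapping.keys E = {}"
  proof (rule ccontr)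
    assume "Poly_Mapping.keys D \<inter> Poly_Mapping.keys E \<noteq> {}"
    then obtain \<nu> where \<nu>: "\<nu> \<in> Poly_Mapping.keys D" "\<nu> \<in> Poly_Mapping.keys E" by blast
    have "(s, \<mu>, t) = (s', \<mu>', t')"
      using presents_key[OF p(1) \<nu>(1)] presents_key[OF p(2) \<nu>(2)] by (rule trans[OF _ sym])
    then show False using p ne by (simp add: presents_def)
  qed
qed

section \<open>The creation operator\<close>

abbreviation twisted_diagrams :: "arc_diagram \<Rightarrow> alg set" where
  "twisted_diagrams Z \<equiv> \<Union>d\<in>twisted_hdata Z. diagrams_of Z d"

lemma twisted_diagramE:
  assumes "D \<in> twisted_diagrams Z"
  obtains s \<mu> t where "D = mk_diagram Z s \<mu> t" "viable_moving Z \<mu>"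
    "horizontals Z s \<mu> t \<noteq> {}" "(hclass \<mu>, s, t) \<in> twisted_hdata Z"
proof -
  obtain d where d: "d \<in> twisted_hdata Z" "D \<in> diagrams_of Z d" using assms by blast
  obtain h s t where h: "d = (h, s, t)" by (cases d)
  obtain \<mu> where \<mu>: "presents Z (s, \<mu>, t) D" "hclass \<mu> = h"
    using d(2) unfolding diagrams_of_def h by auto
  have "viable Z h" using d(1) by (simp add: twisted_hdata_def h)
  with \<mu> have "D = mk_diagram Z s \<mu> t" "mk_diagram Z s \<mu> t \<noteq> 0" "viable_moving Z \<mu>"
    by (auto simp: presents_def viable_moving_def)
  with that d(1) \<mu>(2) show ?thesis unfolding h mk_diagram_neq_0_iff by blast
qed

lemma presents_mk_diagram:
  assumes "viable_moving Z \<mu>" "horizontals Z s \<mu> t \<noteq> {}" "(hclass \<mu>, s, t) \<in> twisted_hdata Z"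
  shows "presents Z (s, \<mu>, t) (mk_diagram Z s \<mu> t)"
  using assms by (simp add: presents_def mk_diagram_neq_0_iff viable_moving_def twisted_hdata_def hdata_def)

lemma mk_diagram_in_diagrams_of:
  assumes "viable_moving Z \<mu>" "horizontals Z s \<mu> t \<noteq> {}" "(hclass \<mu>, s, t) \<in> twisted_hdata Z"
  shows "mk_diagram Z s \<mu> t \<in> diagrams_of Z (hclass \<mu>, s, t)"
  unfolding diagrams_of_def using presents_mk_diagram[OF assms] by auto

lemma mk_diagram_in_twisted_diagrams:
  assumes "viable_moving Z \<mu>" "horizontals Z s \<mu> t \<noteq> {}" "(hclass \<mu>, s, t) \<in> twisted_hdata Z"
  shows "mk_diagram Z s \<mu> t \<in> twisted_diagrams Z"
  using mk_diagram_in_diagrams_of[OF assms] assms(3) by blast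

lemma diagrams_of_subset: "diagrams_of Z d \<subseteq> diagrams Z"
  by (cases d) (auto simp: diagrams_of_def diagrams_def)

lemma independent_subset_diagrams: "B \<subseteq> diagrams Z \<Longrightarrow> F2.independent B"
  using F2.independent_mono[OF independent_diagrams] .

lemma twisted_diagrams_subset: "twisted_diagrams Z \<subseteq> diagrams Z"
  using diagrams_of_subset by blast

lemma linear_creation_operator: "Vector_Spaces.linear scale2 scale2 (creation_operator Z C)"
  unfolding creation_operator_def
  by (rule F2_pair.linear_construct[OF independent_subset_diagrams[OF twisted_diagrams_subset]])

text \<open>All choices in \<open>create_diagram\<close> are evaluated here: the presenting triple
  and the place are unique, and the crossing test becomes a membership test in the domain.\<close>

lemma creation_operator_mk_diagram:
  assumes v: "viable_moving Z \<mu>" and ne: "horizontals Z s \<mu> t \<noteq> {}"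
    and tw: "(hclass \<mu>, s, t) \<in> twisted_hdata Z"
    and o: "all_on_once_occupied Z (hclass \<mu>, s, t) (C (hclass \<mu>, s, t)) p"
  shows "creation_operator Z C (mk_diagram Z s \<mu> t)
    = (if p \<in> dom \<mu> then mk_diagram Z s (join_at p \<mu>) t else 0)"
proof -
  let ?D = "mk_diagram Z s \<mu> t"
  have pr: "presents Z (s, \<mu>, t) ?D" by (rule presents_mk_diagram[OF v ne tw])
  have the: "(THE d. presents Z d ?D) = (s, \<mu>, t)"
  proof (rule the_equality)
    show "presents Z (s, \<mu>, t) ?D" by (rule pr)
    show "d = (s, \<mu>, t)" if "presents Z d ?D" for d by (rule presents_unique[OF that pr])
  qed
  have "creation_operator Z C ?D = create_diagram Z C ?D"
    unfolding creation_operator_def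
    by (rule F2_pair.construct_basis[OF independent_subset_diagrams[OF twisted_diagrams_subset]
          mk_diagram_in_twisted_diagrams[OF v ne tw]])
  then show ?thesis
    unfolding create_diagram_def the using crossing_at_occupied_iff[OF v ne o]
      all_on_once_occupied_unique[OF o] by simp
qed

lemma creation_homotopy_mk_diagram:
  assumes v: "viable_moving Z \<mu>" and ne: "horizontals Z s \<mu> t \<noteq> {}"
    and tw: "(hclass \<mu>, s, t) \<in> twisted_hdata Z"
    and o: "all_on_once_occupied Z (hclass \<mu>, s, t) (C (hclass \<mu>, s, t)) p"
  shows "creation_operator Z C (diff (mk_diagram Z s \<mu> t))
    + diff (creation_operator Z C (mk_diagram Z s \<mu> t)) = mk_diagram Z s \<mu> t"
proof -
  let ?A = "creation_operator Z C" and ?X = "crossed Z s \<mu> t"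
  have A_split: "?A (mk_diagram Z s (split_at u \<mu>) t)
      = (if p \<in> insert u (dom \<mu>) then mk_diagram Z s (join_at p (split_at u \<mu>)) t else 0)"
    if u: "u \<in> ?X" for u
  proof -
    note sp = split_at[OF v crossed_not_in_dom[OF u] crossed_lookup[OF u]]
    have "horizontals Z s (split_at u \<mu>) t \<noteq> {}"
      using u unfolding horizontals_split_at[OF v crossed_not_in_dom[OF u] crossed_lookup[OF u]]
        crossed_def by blast
    \<comment> \<open>Cutting preserves the H-data, so the choice function selects the same pair,
      and hence the same place \<open>p\<close>, for every summand of the differential.\<close>
    from creation_operator_mk_diagram[OF sp(1) this, where C = C and p = p] show ?thesis
      using tw o unfolding sp by blast
  qed
  have A_diff: "?A (diff (mk_diagram Z s \<mu> t))
      = (\<Sum>u\<in>?X. if p \<in> insert u (dom \<mu>) then mk_diagram Z s (join_at p (split_at u \<mu>)) t else 0)"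
    unfolding diff_mk_diagram[OF v] F2_pair.linear_sum[OF linear_creation_operator]
    by (rule sum.cong[OF refl A_split])
  show ?thesis
  proof (cases "p \<in> dom \<mu>")
    case False
    have pX: "p \<in> ?X" by (rule occupied_crossed[OF v ne o False])
    have "?A (diff (mk_diagram Z s \<mu> t))
        = (\<Sum>u\<in>?X. if u = p then mk_diagram Z s (join_at p (split_at p \<mu>)) t else 0)"
      unfolding A_diff by (rule sum.cong) (use False in auto)
    also have "\<dots> = mk_diagram Z s \<mu> t"
      using pX by (simp add: finite_crossed join_at_split_at[OF v False crossed_lookup[OF pX]])
    finally show ?thesis
      using creation_operator_mk_diagram[where C = C, OF v ne tw o] False
      by (simp add: F2_pair.linear_0[OF linear_diff])
  next
    case True
    have pr: "p \<in> ran \<mu>" by (rule occupied_in_ran[OF v o True])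
    note j = join_at[OF v True pr]
    let ?S = "\<Sum>u\<in>?X. mk_diagram Z s (split_at u (join_at p \<mu>)) t"
    have "p \<notin> ?X" using crossed_not_in_dom True by blast
    \<comment> \<open>The joined diagram has the crossings of \<open>\<mu>\<close> and one more at
      \<open>p\<close>; resolving the latter undoes the join. The rest is \<open>?S\<close>, which
      cancels modulo 2 against the other composite.\<close>
    then have "diff (?A (mk_diagram Z s \<mu> t)) = mk_diagram Z s \<mu> t + ?S"
      using True split_at_join_at[OF v True pr] finite_crossed
      by (simp add: creation_operator_mk_diagram[where C = C, OF v ne tw o] diff_mk_diagram[OF j(1)]
          crossed_join_at[OF v ne o True])
    moreover have "?A (diff (mk_diagram Z s \<mu> t)) = ?S"
      unfolding A_diff
    proof (rule sum.cong[OF refl])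
      fix u assume u: "u \<in> ?X"
      show "(if p \<in> insert u (dom \<mu>) then mk_diagram Z s (join_at p (split_at u \<mu>)) t else 0)
          = mk_diagram Z s (split_at u (join_at p \<mu>)) t"
        using True join_at_split_at_commute[OF v True pr crossed_not_in_dom[OF u] crossed_lookup[OF u]]
        by simp
    qed
    ultimately show ?thesis by (simp add: add.left_commute)
  qed
qed

lemma creation_homotopy:
  assumes choice: "creation_choice Z C" and x: "x \<in> twisted_sum Z"
  shows "creation_operator Z C (diff x) + diff (creation_operator Z C x) = x"
  using x unfolding twisted_sum_def
proof (induction rule: F2.span_induct)
  case base
  note A = linear_creation_operator[of Z C]
  let ?L = "\<lambda>x. creation_operator Z C (diff x) + diff (creation_operator Z C x)"
  have L_0: "?L 0 = 0" by (simp only: F2_pair.linear_0[OF A] F2_pair.linear_0[OF linear_diff] add_0)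
  have L_add: "?L (x + y) = ?L x + ?L y" for x y
    by (simp only: F2_pair.linear_add[OF A] F2_pair.linear_add[OF linear_diff] ac_simps)
  have L_scale: "?L (scale2 c x) = scale2 c (?L x)" for c x
    by (simp only: F2_pair.linear_scale[OF A] F2_pair.linear_scale[OF linear_diff]
        F2.scale_right_distrib)
  show ?case
    by (rule F2.subspaceI) (simp_all only: mem_Collect_eq L_0 L_add L_scale)
next
  case (step D)
  obtain s \<mu> t where D: "D = mk_diagram Z s \<mu> t" and v: "viable_moving Z \<mu>"
    and ne: "horizontals Z s \<mu> t \<noteq> {}" and tw: "(hclass \<mu>, s, t) \<in> twisted_hdata Z"
    using twisted_diagramE[OF step] .
  obtain p where o: "all_on_once_occupied Z (hclass \<mu>, s, t) (C (hclass \<mu>, s, t)) p"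
    using choice tw by (auto simp: creation_choice_def)
  show ?case unfolding D by (rule creation_homotopy_mk_diagram[where C = C, OF v ne tw o])
qed

text \<open>Given as a case rule because the value 0 is not a diagram and has no meaningful H-data
  or degree; it lies in every span anyway.\<close>

lemma creation_operator_twisted_diagram:
  assumes "creation_choice Z C" and "D \<in> twisted_diagrams Z"
  obtains "creation_operator Z C D = 0"
  | h s t where "D \<in> diagrams_of Z (h, s, t)" "(h, s, t) \<in> twisted_hdata Z"
    "creation_operator Z C D \<in> diagrams_of Z (h, s, t)"
    "maslov Z (creation_operator Z C D) = maslov Z D + 1"
proof -
  obtain s \<mu> t where D: "D = mk_diagram Z s \<mu> t" and v: "viable_moving Z \<mu>"
    and ne: "horizontals Z s \<mu> t \<noteq> {}" and tw: "(hclass \<mu>, s, t) \<in> twisted_hdata Z"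
    using twisted_diagramE[OF assms(2)] .
  obtain p where o: "all_on_once_occupied Z (hclass \<mu>, s, t) (C (hclass \<mu>, s, t)) p"
    using assms(1) tw by (auto simp: creation_choice_def)
  note A = creation_operator_mk_diagram[where C = C, OF v ne tw o]
  show ?thesis
  proof (cases "p \<in> dom \<mu>")
    case False
    then show ?thesis using that(1) A D by simp
  next
    case True
    have pr: "p \<in> ran \<mu>" by (rule occupied_in_ran[OF v o True])
    note j = join_at[OF v True pr]
    have ne': "horizontals Z s (join_at p \<mu>) t \<noteq> {}"
      using ne unfolding horizontals_join_at[OF v True pr, of s t] by blast
    have "mk_diagram Z s (join_at p \<mu>) t \<in> diagrams_of Z (hclass \<mu>, s, t)"
      using mk_diagram_in_diagrams_of[OF j(1) ne'] tw unfolding j by blast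
    then show ?thesis
      using that(2)[OF _ tw] A True D mk_diagram_in_diagrams_of[OF v ne tw] maslov_join_at[OF v ne o True]
      by simp
  qed
qed

theorem proposition3p17:
  fixes Z :: arc_diagram and C :: "hdata \<Rightarrow> nat"
  assumes "is_arc_diagram Z" and "creation_choice Z C"
  shows "creation_operator Z C ` twisted_sum Z \<subseteq> twisted_sum Z \<and>
    (\<forall>h. \<forall>x \<in> twisted_sum Z \<inter> h_part Z h. creation_operator Z C x \<in> h_part Z h) \<and>
    (\<forall>g. \<forall>x \<in> twisted_sum Z \<inter> maslov_part Z g.
       creation_operator Z C x \<in> maslov_part Z (g + 1)) \<and>
    (\<forall>x \<in> twisted_sum Z. creation_operator Z C (diff x) + diff (creation_operator Z C x) = x) \<and>
    (\<forall>x \<in> twisted_sum Z. diff x = 0 \<longrightarrow> x = diff (creation_operator Z C x))"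
proof -
  note choice = assms(2)
  note A = linear_creation_operator[of Z C]
  note created = creation_operator_twisted_diagram[OF choice]
  show ?thesis
  proof (intro conjI allI ballI impI)
    show "creation_operator Z C ` twisted_sum Z \<subseteq> twisted_sum Z"
    proof (intro subsetI, elim imageE)
      fix x y assume y: "y = creation_operator Z C x" and x: "x \<in> twisted_sum Z"
      have "creation_operator Z C D \<in> F2.span (twisted_diagrams Z)" if "D \<in> twisted_diagrams Z" for D
        using that by (rule created) (auto intro: F2.span_base F2.span_zero)
      from F2_span_image[OF A this] x show "y \<in> twisted_sum Z"
        unfolding y twisted_sum_def by blast
    qed
    fix x assume x: "x \<in> twisted_sum Z"
    show "creation_operator Z C (diff x) + diff (creation_operator Z C x) = x"
      by (rule creation_homotopy[OF choice x])
    then show "x = diff (creation_operator Z C x)" if "diff x = 0"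
      using that by (simp add: F2_pair.linear_0[OF A])
  next
    fix h x assume x: "x \<in> twisted_sum Z \<inter> h_part Z h"
    let ?B = "\<Union>s\<in>Pow (pairs Z). \<Union>t\<in>Pow (pairs Z). diagrams_of Z (h, s, t)"
    \<comment> \<open>Membership in the two spans does not by itself mean that \<open>x\<close> is a
      combination of diagrams satisfying both conditions; independence of all diagrams supplies
      this.\<close>
    have "twisted_diagrams Z \<union> ?B \<subseteq> diagrams Z" using diagrams_of_subset by blast
    from F2_span_Int[OF independent_subset_diagrams[OF this]]
    have xs: "x \<in> F2.span (twisted_diagrams Z \<inter> ?B)"
      using x unfolding twisted_sum_def h_part_def by blast
    have "creation_operator Z C D \<in> F2.span ?B" if D: "D \<in> twisted_diagrams Z \<inter> ?B" for D
    proof -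
      have "D \<in> twisted_diagrams Z" using D by blast
      then show ?thesis
      proof (rule created)
        assume "creation_operator Z C D = 0"
        then show ?thesis by (simp add: F2.span_zero)
      next
        fix h' s t
        assume *: "D \<in> diagrams_of Z (h', s, t)" "(h', s, t) \<in> twisted_hdata Z"
          "creation_operator Z C D \<in> diagrams_of Z (h', s, t)"
        obtain s' t' where "D \<in> diagrams_of Z (h, s', t')" using D by blast
        then obtain \<mu>' where \<mu>': "presents Z (s', \<mu>', t') D" "hclass \<mu>' = h"
          by (auto simp: diagrams_of_def)
        obtain \<mu> where \<mu>: "presents Z (s, \<mu>, t) D" "hclass \<mu> = h'"
          using *(1) by (auto simp: diagrams_of_def)
        \<comment> \<open>The diagram is known both as twisted with class \<open>h'\<close> and as
          homogeneous of class \<open>h\<close>; the uniqueness of its presentation identifies the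
          two.\<close>
        have "h' = h" using presents_unique[OF \<mu>(1) \<mu>'(1)] \<mu>(2) \<mu>'(2) by simp
        moreover have "s \<in> Pow (pairs Z)" "t \<in> Pow (pairs Z)"
          using *(2) by (auto simp: twisted_hdata_def hdata_def)
        ultimately show ?thesis using *(3) by (intro F2.span_base) blast
      qed
    qed
    from F2_span_image[OF A this xs] show "creation_operator Z C x \<in> h_part Z h"
      unfolding h_part_def .
  next
    fix g x assume x: "x \<in> twisted_sum Z \<inter> maslov_part Z g"
    let ?B = "\<lambda>g. {D \<in> diagrams Z. maslov Z D = g}"
    have "twisted_diagrams Z \<union> ?B g \<subseteq> diagrams Z" using diagrams_of_subset by blast
    from F2_span_Int[OF independent_subset_diagrams[OF this]]
    have xs: "x \<in> F2.span (twisted_diagrams Z \<inter> ?B g)"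
      using x unfolding twisted_sum_def maslov_part_def by blast
    have "creation_operator Z C D \<in> F2.span (?B (g + 1))" if D: "D \<in> twisted_diagrams Z \<inter> ?B g" for D
    proof -
      have "D \<in> twisted_diagrams Z" using D by blast
      then show ?thesis
      proof (rule created)
        assume "creation_operator Z C D = 0"
        then show ?thesis by (simp add: F2.span_zero)
      next
        fix h s t
        assume "creation_operator Z C D \<in> diagrams_of Z (h, s, t)"
          "maslov Z (creation_operator Z C D) = maslov Z D + 1"
        then show ?thesis using D diagrams_of_subset[of Z "(h, s, t)"] by (intro F2.span_base) auto
      qed
    qed
    from F2_span_image[OF A this xs] show "creation_operator Z C x \<in> maslov_part Z (g + 1)"
      unfolding maslov_part_def .
  qed
qed

end
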